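(* Let $K$ be a simplicial complex on $[m]$ and let $\lozenge$ be any of the symbols $\psi,\pi,\vartriangle,\triangledown,\cup$ (total chain coproduct, total cochain product, total homology coproduct and its dual product when $H_*^{\mathcal X_m}(K)$ is free, cup product on total cohomology). For indices $(\sigma,\omega),(\sigma',\omega'),(\sigma'',\omega'')\in\mathcal X_m$ write $(\lozenge_K^{\bullet})_l$ for the local coproduct from index $(\sigma,\omega)$ to $(\sigma',\omega')\otimes(\sigma'',\omega'')$ (respectively the local product from $(\sigma',\omega')\otimes(\sigma'',\omega'')$ to $(\sigma,\omega)$), where $\bullet\in\{\mathrm{univ},\mathrm{norm},\mathrm{snorm},\mathrm{spec},\mathrm{wspec}\}$ is the type (universal, normal, strictly normal, special, weakly special). Then $(\lozenge_K^{\bullet})_l=(\lozenge_K^{\mathrm{univ}})_l$ under the following condition, and $(\lozenge_K^{\bullet})_l=0$ otherwise: - universal: $(\sigma'\cup\sigma'')\setminus\sigma\subset\omega\setminus(\omega'\cup\omega'')\in K$; - normal: $\sigma'\cup\sigma''\subset\sigma$ and $\omega\subset\omega'\cup\omega''$; - strictly normal: $\sigma'\cup\sigma''=\sigma$ and $\omega=\omega'\cup\omega''$; - special: $\sigma'\cup\sigma''=\sigma$, $\sigma'\cap\sigma''=\emptyset$, $\omega=\omega'\cup\omega''$, $\omega'\cap\omega''=\emptyset$; - weakly special: $\sigma'\cup\sigma''=\sigma$, $\sigma'\cap\sigma''=\emptyset$, $\omega\setminus(\omega'\cup\omega'')\in K$, $\omega'\cap\omega''=\emptyset$. For the right objects (all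 indices in $\mathcal R_m$, i.e. $\sigma=\sigma'=\sigma''=\emptyset$) the same holds with the conditions: - right universal: $\omega\setminus(\omega'\cup\omega'')\in K$; - right normal: $\omega\subset\omega'\cup\omega''$; - right strictly normal: $\omega=\omega'\cup\omega''$; - right special: $\omega=\omega'\cup\omega''$, $\omega'\cap\omega''=\emptyset$; - right weakly special: $\omega\setminus(\omega'\cup\omega'')\in K$, $\omega'\cap\omega''=\emptyset$.
   Context: $[m]=\{1,\dots,m\}$; a simplicial complex on $[m]$ is a set of subsets closed under taking subsets (ghost vertices, void complex, $\{\emptyset\}$ allowed). $\mathcal X=\{\mathrm e,\mathrm n,\mathrm i\}$; $\mathcal X_m=\{(\sigma,\omega):\sigma,\omega\subset[m],\sigma\cap\omega=\emptyset\}\cong\mathcal X^m$ ($s_k=\mathrm e,\mathrm n,\mathrm i$ for $k\in\sigma$, $k\in\omega$, otherwise); $\mathcal R_m=\{(\emptyset,\omega):\omega\subset[m]\}$. $T_*^{\mathcal X}$ is the chain complex free on $\mathrm i,\mathrm n,\mathrm e$ (degree $0$) and $\bar{\mathrm n}$ (degree $1$), $d\bar{\mathrm n}=\mathrm n$; $\mathrm n,\bar{\mathrm n}$ have index $\mathrm n$, while $\mathrm i$ and $\mathrm e$ have index $\mathrm i$ and $\mathrm e$; $S_*^{\mathcal X}=\mathbb Z(\mathrm n,\mathrm i)$ is the subcomplex free on $\mathrm n,\mathrm i$. $T_*^{\mathcal X_m}(K)=\sum_{\tau\in K}U_1\otimes\cdots\otimes U_m\subset(T_*^{\mathcal X})^{\otimes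 m}$, $U_k=T_*^{\mathcal X}$ if $k\in\tau$, $S_*^{\mathcal X}$ otherwise ($0$ for the void complex); it is a direct sum of local complexes $T_*^{\sigma,\omega}(K)$; $H_*^{\mathcal X_m}(K)=\oplus H_*^{\sigma,\omega}(K)$ is its homology, $T^*_{\mathcal X_m}(K)$ its dual, $H^*_{\mathcal X_m}(K)=\oplus H^*_{\sigma,\omega}(K)$ the cohomology. Coproducts on $T_*^{\mathcal X}$ (writing $ab$ for $a\otimes b$; not required to preserve degree or index): - universal: $\mathrm i\mapsto\mathrm{ii+in+ni+nn}$; $\mathrm n\mapsto\mathrm{nn+ni+in}$; $\bar{\mathrm n}\mapsto\bar{\mathrm n}\mathrm n+\bar{\mathrm n}\mathrm i+\mathrm i\bar{\mathrm n}+\mathrm{ee+ei+ie+ii}$; $\mathrm e\mapsto\mathrm{ee+ei+ie+ii}$. - normal: $\mathrm i\mapsto\mathrm{ii+in+ni+nn}$; $\mathrm n\mapsto\mathrm{nn+ni+in}$; $\bar{\mathrm n}\mapsto\bar{\mathrm n}\mathrm n+\bar{\mathrm n}\mathrm i+\mathrm i\bar{\mathrm n}$; $\mathrm e\mapsto\mathrm{ee+ei+ie+ii}$. - strictly normal: $\mathrm i\mapsto\mathrm{ii}$; $\mathrm n\mapsto\mathrm{nn+ni+in}$; $\bar{\mathrm n}\mapsto\bar{\mathrm n}\mathrm n+\bar{\mathrm n}\mathrm i+\mathrm i\bar{\mathrm n}$; $\mathrm e\mapsto\mathrm{ee+ei+ie}$. - special: $\mathrm i\mapsto\mathrm{ii}$;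 $\mathrm n\mapsto\mathrm{ni+in}$; $\bar{\mathrm n}\mapsto\bar{\mathrm n}\mathrm i+\mathrm i\bar{\mathrm n}$; $\mathrm e\mapsto\mathrm{ei+ie}$. - weakly special: $\mathrm i\mapsto\mathrm{ii}$; $\mathrm n\mapsto\mathrm{ni+in}$; $\bar{\mathrm n}\mapsto\bar{\mathrm n}\mathrm i+\mathrm i\bar{\mathrm n}+\mathrm{ii}$; $\mathrm e\mapsto\mathrm{ei+ie}$. Tensor product of coproducts: $(\psi_A\otimes\psi_B)(a\otimes b)=\sum(-1)^{|a''||b'|}(a'\otimes b')\otimes(a''\otimes b'')$ where $\psi_A(a)=\sum a'\otimes a''$, $\psi_B(b)=\sum b'\otimes b''$. For each type with coproduct $\psi$ on $T_*^{\mathcal X}$, $\psi^{(m)}=\psi\otimes\cdots\otimes\psi$ on $(T_*^{\mathcal X})^{\otimes m}$ restricts to a coproduct $\psi_K$ on $T_*^{\mathcal X_m}(K)$; $\pi_K$ is the dual product on $T^*_{\mathcal X_m}(K)$. If $H_*^{\mathcal X_m}(K)$ is free, $\psi_K$ induces $\vartriangle_K$ on $H_*^{\mathcal X_m}(K)$, with dual product $\triangledown_K$ on $H^*_{\mathcal X_m}(K)$; in general $[x]\cup_K[y]=[\pi_K(x\otimes y)]$ on $H^*_{\mathcal X_m}(K)$. A superscript $\bullet$ on any of these indicates the type of the coproduct $\psi$ used. Local (co)products: for a coproduct $\vartriangle$ on $A=\oplus_sA^s$, the local coproduct $\vartriangle^s_{s',s''}\colon A^s\to A^{s'}\otimes A^{s''}$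 is the composite inclusion–coproduct–projection; dually local products $A_{s'}\otimes A_{s''}\to A_s$. On homology, the local coproduct sends $[x]$ to $[(\psi_K)^s_{s',s''}(x)]$, and on cohomology the local product sends $[x]\otimes[y]$ to $[(\pi_K)_s^{s',s''}(x\otimes y)]$. The right universal, right normal, etc. objects are the restrictions to $\mathcal R_m$: only the local groups and local (co)products with all three indices in $\mathcal R_m$ are kept.
   Formalization: In the weakly special and right weakly special conditions, ω'∪ω''⊂ω is added; as printed the claim fails for m=1, K={∅}, all σ's, ω, ω'' empty, ω'={1}: the universal local coproduct is i↦n⊗i, the weakly special one is 0. *)

theory Defs
  imports "HOL-Algebra.Free_Abelian_Groups"
begin

section \<open>Duals, tensor products and homology of abelian groups\<close>

text \<open>The dual \<open>Hom(G, \<int>)\<close>; homomorphisms are taken extensional so that equality of functions is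
  equality in the dual.\<close>

definition dual_group :: "('a, 'b) monoid_scheme \<Rightarrow> ('a \<Rightarrow> int) monoid" where
  "dual_group G = \<lparr>carrier = hom G integer_group \<inter> extensional (carrier G),
                   monoid.mult = (\<lambda>f g. \<lambda>x\<in>carrier G. f x + g x),
                   one = (\<lambda>x\<in>carrier G. 0)\<rparr>"

definition tensor_relators ::
    "('a, 'c) monoid_scheme \<Rightarrow> ('b, 'd) monoid_scheme \<Rightarrow> ('a \<times> 'b \<Rightarrow>\<^sub>0 int) set" where
  "tensor_relators G H =
     {frag_of (x \<otimes>\<^bsub>G\<^esub> y, z) - frag_of (x, z) - frag_of (y, z) | x y z.
        x \<in> carrier G \<and> y \<in> carrier G \<and> z \<in> carrier H} \<union>
     {frag_of (x, y \<otimes>\<^bsub>H\<^esub> z) - frag_of (x, y) - frag_of (x, z) | x y z.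
        x \<in> carrier G \<and> y \<in> carrier H \<and> z \<in> carrier H}"

text \<open>The tensor product over \<open>\<int>\<close> of two abelian groups (written multiplicatively).\<close>

definition tensor_group ::
    "('a, 'c) monoid_scheme \<Rightarrow> ('b, 'd) monoid_scheme \<Rightarrow> ('a \<times> 'b \<Rightarrow>\<^sub>0 int) set monoid" where
  "tensor_group G H =
     (let F = free_Abelian_group (carrier G \<times> carrier H)
      in F Mod generate F (tensor_relators G H))"

text \<open>On free abelian groups with given bases the tensor product is the free abelian group on the
  pairs of basis elements.\<close>

definition frag_tensor :: "('a \<Rightarrow>\<^sub>0 int) \<Rightarrow> ('b \<Rightarrow>\<^sub>0 int) \<Rightarrow> ('a \<times> 'b \<Rightarrow>\<^sub>0 int)" where
  "frag_tensor x y = frag_extend (\<lambda>a. frag_extend (\<lambda>b. frag_of (a, b)) y) x"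

definition pair_eval :: "('a \<Rightarrow> int) \<Rightarrow> ('b \<Rightarrow> int) \<Rightarrow> ('a \<times> 'b \<Rightarrow>\<^sub>0 int) \<Rightarrow> int" where
  "pair_eval f g z =
     (\<Sum>p\<in>Poly_Mapping.keys z. Poly_Mapping.lookup z p * (f (fst p) * g (snd p)))"

definition free_abelian :: "('a, 'b) monoid_scheme \<Rightarrow> bool" where
  "free_abelian G \<longleftrightarrow> (\<exists>S\<subseteq>carrier G. G \<cong> free_Abelian_group S)"

text \<open>A complex is given by its total group \<open>G\<close> (the direct sum over all degrees) and its
  differential \<open>d\<close>; its homology is likewise the direct sum over all degrees.\<close>

definition cx_homology :: "('a, 'b) monoid_scheme \<Rightarrow> ('a \<Rightarrow> 'a) \<Rightarrow> 'a set monoid" where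
  "cx_homology G d = (G\<lparr>carrier := kernel G G d\<rparr>) Mod (d ` carrier G)"

definition cx_class :: "('a, 'b) monoid_scheme \<Rightarrow> ('a \<Rightarrow> 'a) \<Rightarrow> 'a \<Rightarrow> 'a set" where
  "cx_class G d x = (d ` carrier G) #>\<^bsub>G\<^esub> x"

section \<open>The complexes\<close>

text \<open>\<open>Gnb\<close> stands for the degree one generator \<open>n\<close>-bar.\<close>

datatype gen = Gi | Gn | Gnb | Ge

fun gen_deg :: "gen \<Rightarrow> nat" where
  "gen_deg Gnb = 1"
| "gen_deg _ = 0"

fun gen_d :: "gen \<Rightarrow> (gen \<Rightarrow>\<^sub>0 int)" where
  "gen_d Gnb = frag_of Gn"
| "gen_d _ = 0"

text \<open>The tensor power of exponent \<open>m\<close> is free on the words of length \<open>m\<close>; the \<open>k\<close>-th tensor factor,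
  \<open>k \<in> {1..m}\<close>, is the list entry at position \<open>k - 1\<close>.\<close>

definition word_deg :: "gen list \<Rightarrow> nat" where
  "word_deg w = sum_list (map gen_deg w)"

primrec word_d :: "gen list \<Rightarrow> (gen list \<Rightarrow>\<^sub>0 int)" where
  "word_d [] = 0"
| "word_d (a # w) =
     frag_extend (\<lambda>b. frag_of (b # w)) (gen_d a) +
     frag_cmul ((- 1) ^ gen_deg a) (frag_extend (\<lambda>v. frag_of (a # v)) (word_d w))"

definition pair_d :: "gen list \<times> gen list \<Rightarrow> (gen list \<times> gen list \<Rightarrow>\<^sub>0 int)" where
  "pair_d p = frag_tensor (word_d (fst p)) (frag_of (snd p)) +
     frag_cmul ((- 1) ^ word_deg (fst p)) (frag_tensor (frag_of (fst p)) (word_d (snd p)))"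

definition simplicial_complex_on :: "nat \<Rightarrow> nat set set \<Rightarrow> bool" where
  "simplicial_complex_on m K \<longleftrightarrow>
     (\<forall>\<tau>\<in>K. \<tau> \<subseteq> {1..m}) \<and> (\<forall>\<tau>\<in>K. \<forall>\<rho>. \<rho> \<subseteq> \<tau> \<longrightarrow> \<rho> \<in> K)"

type_synonym index = "nat set \<times> nat set"

definition index_set :: "nat \<Rightarrow> index set" where
  "index_set m = {(\<sigma>, \<omega>). \<sigma> \<subseteq> {1..m} \<and> \<omega> \<subseteq> {1..m} \<and> \<sigma> \<inter> \<omega> = {}}"

definition word_index :: "gen list \<Rightarrow> index" where
  "word_index w = ({k \<in> {1..length w}. w ! (k - 1) = Ge},
                   {k \<in> {1..length w}. w ! (k - 1) \<in> {Gn, Gnb}})"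

text \<open>The sum over \<open>\<tau> \<in> K\<close> of the subgroups \<open>U\<^sub>1 \<otimes> \<dots> \<otimes> U\<^sub>m\<close> is free on the union of their bases.\<close>

definition T_basis :: "nat \<Rightarrow> nat set set \<Rightarrow> gen list set" where
  "T_basis m K = (\<Union>\<tau>\<in>K. {w. length w = m \<and>
     (\<forall>k\<in>{1..m}. w ! (k - 1) \<in> (if k \<in> \<tau> then UNIV else {Gn, Gi}))})"

definition T_total :: "nat \<Rightarrow> nat set set \<Rightarrow> (gen list \<Rightarrow>\<^sub>0 int) monoid" where
  "T_total m K = free_Abelian_group (T_basis m K)"

definition local_basis :: "nat \<Rightarrow> nat set set \<Rightarrow> index \<Rightarrow> gen list set" where
  "local_basis m K s = {w \<in> T_basis m K. word_index w = s}"

definition T_loc :: "nat \<Rightarrow> nat set set \<Rightarrow> index \<Rightarrow> (gen list \<Rightarrow>\<^sub>0 int) monoid" where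
  "T_loc m K s = free_Abelian_group (local_basis m K s)"

definition TT_loc ::
    "nat \<Rightarrow> nat set set \<Rightarrow> index \<Rightarrow> index \<Rightarrow> (gen list \<times> gen list \<Rightarrow>\<^sub>0 int) monoid" where
  "TT_loc m K s' s'' = free_Abelian_group (local_basis m K s' \<times> local_basis m K s'')"

definition H_total :: "nat \<Rightarrow> nat set set \<Rightarrow> (gen list \<Rightarrow>\<^sub>0 int) set monoid" where
  "H_total m K = cx_homology (T_total m K) (frag_extend word_d)"

definition H_loc :: "nat \<Rightarrow> nat set set \<Rightarrow> index \<Rightarrow> (gen list \<Rightarrow>\<^sub>0 int) set monoid" where
  "H_loc m K s = cx_homology (T_loc m K s) (frag_extend word_d)"

definition D_loc :: "nat \<Rightarrow> nat set set \<Rightarrow> index \<Rightarrow> ((gen list \<Rightarrow>\<^sub>0 int) \<Rightarrow> int) monoid" where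
  "D_loc m K s = dual_group (T_loc m K s)"

definition codiff ::
    "nat \<Rightarrow> nat set set \<Rightarrow> index \<Rightarrow> ((gen list \<Rightarrow>\<^sub>0 int) \<Rightarrow> int) \<Rightarrow> ((gen list \<Rightarrow>\<^sub>0 int) \<Rightarrow> int)" where
  "codiff m K s f = (\<lambda>x\<in>carrier (T_loc m K s). f (frag_extend word_d x))"

definition Hco_loc :: "nat \<Rightarrow> nat set set \<Rightarrow> index \<Rightarrow> ((gen list \<Rightarrow>\<^sub>0 int) \<Rightarrow> int) set monoid" where
  "Hco_loc m K s = cx_homology (D_loc m K s) (codiff m K s)"

section \<open>The five coproducts\<close>

datatype coprod_type = Universal | Normal | Strictly_Normal | Special | Weakly_Special

definition frag_list :: "'a list \<Rightarrow> ('a \<Rightarrow>\<^sub>0 int)" where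
  "frag_list xs = sum_list (map frag_of xs)"

fun gen_coprod :: "coprod_type \<Rightarrow> gen \<Rightarrow> (gen \<times> gen \<Rightarrow>\<^sub>0 int)" where
  "gen_coprod Universal Gi = frag_list [(Gi,Gi), (Gi,Gn), (Gn,Gi), (Gn,Gn)]"
| "gen_coprod Universal Gn = frag_list [(Gn,Gn), (Gn,Gi), (Gi,Gn)]"
| "gen_coprod Universal Gnb =
     frag_list [(Gnb,Gn), (Gnb,Gi), (Gi,Gnb), (Ge,Ge), (Ge,Gi), (Gi,Ge), (Gi,Gi)]"
| "gen_coprod Universal Ge = frag_list [(Ge,Ge), (Ge,Gi), (Gi,Ge), (Gi,Gi)]"
| "gen_coprod Normal Gi = frag_list [(Gi,Gi), (Gi,Gn), (Gn,Gi), (Gn,Gn)]"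
| "gen_coprod Normal Gn = frag_list [(Gn,Gn), (Gn,Gi), (Gi,Gn)]"
| "gen_coprod Normal Gnb = frag_list [(Gnb,Gn), (Gnb,Gi), (Gi,Gnb)]"
| "gen_coprod Normal Ge = frag_list [(Ge,Ge), (Ge,Gi), (Gi,Ge), (Gi,Gi)]"
| "gen_coprod Strictly_Normal Gi = frag_list [(Gi,Gi)]"
| "gen_coprod Strictly_Normal Gn = frag_list [(Gn,Gn), (Gn,Gi), (Gi,Gn)]"
| "gen_coprod Strictly_Normal Gnb = frag_list [(Gnb,Gn), (Gnb,Gi), (Gi,Gnb)]"
| "gen_coprod Strictly_Normal Ge = frag_list [(Ge,Ge), (Ge,Gi), (Gi,Ge)]"
| "gen_coprod Special Gi = frag_list [(Gi,Gi)]"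
| "gen_coprod Special Gn = frag_list [(Gn,Gi), (Gi,Gn)]"
| "gen_coprod Special Gnb = frag_list [(Gnb,Gi), (Gi,Gnb)]"
| "gen_coprod Special Ge = frag_list [(Ge,Gi), (Gi,Ge)]"
| "gen_coprod Weakly_Special Gi = frag_list [(Gi,Gi)]"
| "gen_coprod Weakly_Special Gn = frag_list [(Gn,Gi), (Gi,Gn)]"
| "gen_coprod Weakly_Special Gnb = frag_list [(Gnb,Gi), (Gi,Gnb), (Gi,Gi)]"
| "gen_coprod Weakly_Special Ge = frag_list [(Ge,Gi), (Gi,Ge)]"

text \<open>The tensor power of the coproduct, with the sign \<open>(-1)\<close> to the power \<open>|a''| |w'|\<close>.\<close>

primrec word_coprod :: "coprod_type \<Rightarrow> gen list \<Rightarrow> (gen list \<times> gen list \<Rightarrow>\<^sub>0 int)" where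
  "word_coprod t [] = frag_of ([], [])"
| "word_coprod t (a # w) =
     frag_extend (\<lambda>(a', a''). frag_extend (\<lambda>(w', w'').
         frag_cmul ((- 1) ^ (gen_deg a'' * word_deg w')) (frag_of (a' # w', a'' # w'')))
       (word_coprod t w)) (gen_coprod t a)"

definition total_psi ::
    "coprod_type \<Rightarrow> (gen list \<Rightarrow>\<^sub>0 int) \<Rightarrow> (gen list \<times> gen list \<Rightarrow>\<^sub>0 int)" where
  "total_psi t = frag_extend (word_coprod t)"

definition pair_proj ::
    "index \<Rightarrow> index \<Rightarrow> (gen list \<times> gen list \<Rightarrow>\<^sub>0 int) \<Rightarrow> (gen list \<times> gen list \<Rightarrow>\<^sub>0 int)" where
  "pair_proj s' s'' = frag_extend (\<lambda>(u, v).
     if word_index u = s' \<and> word_index v = s'' then frag_of (u, v) else 0)"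

section \<open>Local coproducts and products\<close>

text \<open>In all operations below the source index of a coproduct (target index of a product) comes first.
  The local products are given as bilinear maps.\<close>

definition loc_psi :: "coprod_type \<Rightarrow> nat \<Rightarrow> nat set set \<Rightarrow> index \<Rightarrow> index \<Rightarrow> index \<Rightarrow>
    (gen list \<Rightarrow>\<^sub>0 int) \<Rightarrow> (gen list \<times> gen list \<Rightarrow>\<^sub>0 int)" where
  "loc_psi t m K s s' s'' = (\<lambda>x\<in>carrier (T_loc m K s). pair_proj s' s'' (total_psi t x))"

definition loc_pi :: "coprod_type \<Rightarrow> nat \<Rightarrow> nat set set \<Rightarrow> index \<Rightarrow> index \<Rightarrow> index \<Rightarrow>
    ((gen list \<Rightarrow>\<^sub>0 int) \<Rightarrow> int) \<Rightarrow> ((gen list \<Rightarrow>\<^sub>0 int) \<Rightarrow> int) \<Rightarrow> ((gen list \<Rightarrow>\<^sub>0 int) \<Rightarrow> int)" where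
  "loc_pi t m K s s' s'' f g = (\<lambda>x\<in>carrier (T_loc m K s).
     pair_eval (\<lambda>u. f (frag_of u)) (\<lambda>v. g (frag_of v)) (loc_psi t m K s s' s'' x))"

text \<open>The Kuenneth map from the tensor product of the homology groups to the homology of the tensor
  product, sending \<open>[x] \<otimes> [y]\<close> to \<open>[x \<otimes> y]\<close>. It does not depend on the representatives, and it is
  bijective when the homology groups are free.\<close>

definition kuenneth :: "nat \<Rightarrow> nat set set \<Rightarrow> index \<Rightarrow> index \<Rightarrow>
    ((gen list \<Rightarrow>\<^sub>0 int) set \<times> (gen list \<Rightarrow>\<^sub>0 int) set \<Rightarrow>\<^sub>0 int) set \<Rightarrow>
    (gen list \<times> gen list \<Rightarrow>\<^sub>0 int) set" where
  "kuenneth m K s' s'' t = (\<Union>q\<in>t. cx_class (TT_loc m K s' s'') (frag_extend pair_d)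
     (frag_extend (\<lambda>(a, b). frag_tensor (SOME x. x \<in> a) (SOME y. y \<in> b)) q))"

text \<open>The local coproduct on homology sends \<open>[x]\<close> to the class of \<open>loc_psi x\<close>, transported along
  the Kuenneth isomorphism. The union over the representatives \<open>x\<close> of \<open>c\<close> is the usual lifting of a
  function to a quotient. With the sign rule of \<open>word_coprod\<close>, the local coproducts that remove
  elements of \<open>\<omega>\<close> (universal and weakly special types only) commute with the differentials only up to
  signs that can depend on the term; if such a component does not descend to homology,
  the operation below is merely some function determined by \<open>loc_psi\<close>.\<close>

definition loc_hcoprod :: "coprod_type \<Rightarrow> nat \<Rightarrow> nat set set \<Rightarrow> index \<Rightarrow> index \<Rightarrow> index \<Rightarrow>
    (gen list \<Rightarrow>\<^sub>0 int) set \<Rightarrow>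
    ((gen list \<Rightarrow>\<^sub>0 int) set \<times> (gen list \<Rightarrow>\<^sub>0 int) set \<Rightarrow>\<^sub>0 int) set" where
  "loc_hcoprod t m K s s' s'' c =
     inv_into (carrier (tensor_group (H_loc m K s') (H_loc m K s''))) (kuenneth m K s' s'')
       (\<Union>x\<in>c. cx_class (TT_loc m K s' s'') (frag_extend pair_d) (loc_psi t m K s s' s'' x))"

text \<open>Evaluation of cohomology classes on homology classes; when the homology is free, it identifies
  cohomology with the dual of homology.\<close>

definition hom_eval :: "nat \<Rightarrow> nat set set \<Rightarrow> index \<Rightarrow>
    ((gen list \<Rightarrow>\<^sub>0 int) \<Rightarrow> int) set \<Rightarrow> ((gen list \<Rightarrow>\<^sub>0 int) set \<Rightarrow> int)" where
  "hom_eval m K s a = (\<lambda>c\<in>carrier (H_loc m K s). (SOME f. f \<in> a) (SOME x. x \<in> c))"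

text \<open>The value of \<open>\<phi> \<otimes> \<chi>\<close> on an element \<open>t\<close> of a tensor product (a coset of formal sums of pairs).\<close>

definition tensor_eval :: "('a \<Rightarrow> int) \<Rightarrow> ('b \<Rightarrow> int) \<Rightarrow> ('a \<times> 'b \<Rightarrow>\<^sub>0 int) set \<Rightarrow> int" where
  "tensor_eval \<phi> \<chi> t = pair_eval \<phi> \<chi> (SOME q. q \<in> t)"

definition loc_hprod :: "coprod_type \<Rightarrow> nat \<Rightarrow> nat set set \<Rightarrow> index \<Rightarrow> index \<Rightarrow> index \<Rightarrow>
    ((gen list \<Rightarrow>\<^sub>0 int) \<Rightarrow> int) set \<Rightarrow> ((gen list \<Rightarrow>\<^sub>0 int) \<Rightarrow> int) set \<Rightarrow>
    ((gen list \<Rightarrow>\<^sub>0 int) \<Rightarrow> int) set" where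
  "loc_hprod t m K s s' s'' a b =
     inv_into (carrier (Hco_loc m K s)) (hom_eval m K s)
       (\<lambda>c\<in>carrier (H_loc m K s).
          tensor_eval (hom_eval m K s' a) (hom_eval m K s'' b) (loc_hcoprod t m K s s' s'' c))"

definition loc_cup :: "coprod_type \<Rightarrow> nat \<Rightarrow> nat set set \<Rightarrow> index \<Rightarrow> index \<Rightarrow> index \<Rightarrow>
    ((gen list \<Rightarrow>\<^sub>0 int) \<Rightarrow> int) set \<Rightarrow> ((gen list \<Rightarrow>\<^sub>0 int) \<Rightarrow> int) set \<Rightarrow>
    ((gen list \<Rightarrow>\<^sub>0 int) \<Rightarrow> int) set" where
  "loc_cup t m K s s' s'' a b =
     (\<Union>f\<in>a. \<Union>g\<in>b. cx_class (D_loc m K s) (codiff m K s) (loc_pi t m K s s' s'' f g))"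

section \<open>The conditions\<close>

text \<open>In the weakly special case \<open>\<omega>' \<union> \<omega>'' \<subseteq> \<omega>\<close> is an explicit part of the condition: the weakly special
  coproduct sends \<open>i\<close> to \<open>ii\<close>, whereas the universal one also has the terms \<open>in + ni + nn\<close>.\<close>

fun loc_cond :: "coprod_type \<Rightarrow> nat set set \<Rightarrow> index \<Rightarrow> index \<Rightarrow> index \<Rightarrow> bool" where
  "loc_cond Universal K (\<sigma>, \<omega>) (\<sigma>', \<omega>') (\<sigma>'', \<omega>'') \<longleftrightarrow>
     (\<sigma>' \<union> \<sigma>'') - \<sigma> \<subseteq> \<omega> - (\<omega>' \<union> \<omega>'') \<and> \<omega> - (\<omega>' \<union> \<omega>'') \<in> K"
| "loc_cond Normal K (\<sigma>, \<omega>) (\<sigma>', \<omega>') (\<sigma>'', \<omega>'') \<longleftrightarrow>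
     \<sigma>' \<union> \<sigma>'' \<subseteq> \<sigma> \<and> \<omega> \<subseteq> \<omega>' \<union> \<omega>''"
| "loc_cond Strictly_Normal K (\<sigma>, \<omega>) (\<sigma>', \<omega>') (\<sigma>'', \<omega>'') \<longleftrightarrow>
     \<sigma>' \<union> \<sigma>'' = \<sigma> \<and> \<omega> = \<omega>' \<union> \<omega>''"
| "loc_cond Special K (\<sigma>, \<omega>) (\<sigma>', \<omega>') (\<sigma>'', \<omega>'') \<longleftrightarrow>
     \<sigma>' \<union> \<sigma>'' = \<sigma> \<and> \<sigma>' \<inter> \<sigma>'' = {} \<and> \<omega> = \<omega>' \<union> \<omega>'' \<and> \<omega>' \<inter> \<omega>'' = {}"
| "loc_cond Weakly_Special K (\<sigma>, \<omega>) (\<sigma>', \<omega>') (\<sigma>'', \<omega>'') \<longleftrightarrow>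
     \<sigma>' \<union> \<sigma>'' = \<sigma> \<and> \<sigma>' \<inter> \<sigma>'' = {} \<and> \<omega>' \<union> \<omega>'' \<subseteq> \<omega> \<and>
     \<omega> - (\<omega>' \<union> \<omega>'') \<in> K \<and> \<omega>' \<inter> \<omega>'' = {}"

fun right_cond :: "coprod_type \<Rightarrow> nat set set \<Rightarrow> nat set \<Rightarrow> nat set \<Rightarrow> nat set \<Rightarrow> bool" where
  "right_cond Universal K \<omega> \<omega>' \<omega>'' \<longleftrightarrow> \<omega> - (\<omega>' \<union> \<omega>'') \<in> K"
| "right_cond Normal K \<omega> \<omega>' \<omega>'' \<longleftrightarrow> \<omega> \<subseteq> \<omega>' \<union> \<omega>''"
| "right_cond Strictly_Normal K \<omega> \<omega>' \<omega>'' \<longleftrightarrow> \<omega> = \<omega>' \<union> \<omega>''"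
| "right_cond Special K \<omega> \<omega>' \<omega>'' \<longleftrightarrow> \<omega> = \<omega>' \<union> \<omega>'' \<and> \<omega>' \<inter> \<omega>'' = {}"
| "right_cond Weakly_Special K \<omega> \<omega>' \<omega>'' \<longleftrightarrow>
     \<omega>' \<union> \<omega>'' \<subseteq> \<omega> \<and> \<omega> - (\<omega>' \<union> \<omega>'') \<in> K \<and> \<omega>' \<inter> \<omega>'' = {}"

text \<open>Each of the five local operations of type \<open>t\<close> agrees with the universal one if \<open>C\<close> holds, and is
  zero otherwise (\<open>\<one>\<close> being the zero of the groups, which are written multiplicatively).\<close>

definition universal_or_zero ::
    "coprod_type \<Rightarrow> nat \<Rightarrow> nat set set \<Rightarrow> index \<Rightarrow> index \<Rightarrow> index \<Rightarrow> bool \<Rightarrow> bool" where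
  "universal_or_zero t m K s s' s'' C \<longleftrightarrow>
     (\<forall>x\<in>carrier (T_loc m K s).
        loc_psi t m K s s' s'' x =
          (if C then loc_psi Universal m K s s' s'' x else \<one>\<^bsub>TT_loc m K s' s''\<^esub>)) \<and>
     (\<forall>f\<in>carrier (D_loc m K s'). \<forall>g\<in>carrier (D_loc m K s'').
        loc_pi t m K s s' s'' f g =
          (if C then loc_pi Universal m K s s' s'' f g else \<one>\<^bsub>D_loc m K s\<^esub>)) \<and>
     (free_abelian (H_total m K) \<longrightarrow>
        (\<forall>c\<in>carrier (H_loc m K s).
           loc_hcoprod t m K s s' s'' c =
             (if C then loc_hcoprod Universal m K s s' s'' c
              else \<one>\<^bsub>tensor_group (H_loc m K s') (H_loc m K s'')\<^esub>)) \<and>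
        (\<forall>a\<in>carrier (Hco_loc m K s'). \<forall>b\<in>carrier (Hco_loc m K s'').
           loc_hprod t m K s s' s'' a b =
             (if C then loc_hprod Universal m K s s' s'' a b else \<one>\<^bsub>Hco_loc m K s\<^esub>))) \<and>
     (\<forall>a\<in>carrier (Hco_loc m K s'). \<forall>b\<in>carrier (Hco_loc m K s'').
        loc_cup t m K s s' s'' a b =
          (if C then loc_cup Universal m K s s' s'' a b else \<one>\<^bsub>Hco_loc m K s\<^esub>))"

end

theory Submission
  imports Defs
begin

text \<open>
  The coproduct of a word is the tensor product of the coproducts of its letters. Hence the coefficient
  of \<open>u \<otimes> v\<close> in the coproduct of \<open>w\<close> is, up to a sign that does not depend on the type, the product over
  all positions of the coefficients of the letter coproducts (\<open>lookup_word_coprod_Cons\<close>). The condition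
  on the three indices is a condition at each position, on the indices of the letters there, together
  with the requirement \<open>\<omega> - (\<omega>' \<union> \<omega>'') \<in> K\<close> for the universal and the weakly special type
  (\<open>loc_cond_iff_positions\<close>). A look at the five tables of letter coproducts shows that, where the
  condition at a position holds, the letter coefficient of each type is the universal one, and that it
  vanishes otherwise. At a position of \<open>\<omega> - (\<omega>' \<union> \<omega>'')\<close> a nonzero coefficient forces the letter
  \<open>n\<close>-bar, and the positions that carry \<open>n\<close>-bar form a simplex; this is where \<open>K\<close> enters. So the theorem
  holds for the chain coproduct (\<open>loc_psi_universal\<close>, \<open>loc_psi_zero\<close>).

  The other four operations are defined from the chain coproduct, so they agree with the universal ones
  wherever the chain coproduct does. It remains to see that they vanish with it. The cochain product
  and the cup product vanish because the pairing with the zero chain is zero. The other two need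
  an argument, since each is the preimage of zero under a map.

  The homology coproduct is a preimage under the Kuenneth map \<open>H(A) \<otimes> H(B) \<rightarrow> H(A \<otimes> B)\<close>, so this map must have
  trivial kernel (\<open>kuenneth_eq_boundaries_iff\<close>). The cycles of a finitely generated free complex are the
  common kernel of finitely many integral functionals, and therefore a direct summand
  (\<open>retraction_onto_common_kernel\<close>). This gives a homomorphism \<open>A \<rightarrow> H(A)\<close> that is the projection on cycles and
  kills boundaries; the tensor product of two of these is a left inverse of the Kuenneth map.

  The product dual to the homology coproduct is a preimage under the evaluation of cohomology classes
  on homology classes, so a cocycle that vanishes on cycles must be a coboundary. If the total homology is
  free, the boundaries are a direct summand of the cycles and hence of the chains, so a homomorphism
  defined on boundaries extends to all chains (\<open>cocycle_vanishing_on_cycles\<close>); the local complexes inherit this as direct summands.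
\<close>

section \<open>Induction on formal sums\<close>

lemma frag_induct [case_names zero one diff]:
  "P 0 \<Longrightarrow> (\<And>a. P (frag_of a)) \<Longrightarrow> (\<And>a b. P a \<Longrightarrow> P b \<Longrightarrow> P (a - b)) \<Longrightarrow> P x"
  by (rule frag_induction[where S = UNIV]) auto

lemma frag_induct_on [consumes 1, case_names zero basis diff]:
  assumes "Poly_Mapping.keys x \<subseteq> S" "P 0" "\<And>a. a \<in> S \<Longrightarrow> P (frag_of a)"
    and "\<And>x y. Poly_Mapping.keys x \<subseteq> S \<Longrightarrow> Poly_Mapping.keys y \<subseteq> S \<Longrightarrow> P x \<Longrightarrow> P y \<Longrightarrow> P (x - y)"
  shows "P x"
  by (rule free_Abelian_group_induct[OF assms(1)]) (simp_all add: assms(2-4))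

section \<open>Differential groups and dual groups\<close>

text \<open>Chains and cochains are treated alike: both are abelian groups with an endomorphism of square zero,
  whose homology is the sum over all degrees.\<close>

locale differential_group = comm_group G for G (structure) +
  fixes d
  assumes d_hom: "d \<in> hom G G"
    and d_d: "x \<in> carrier G \<Longrightarrow> d (d x) = \<one>"
begin

sublocale d: group_hom G G d
  by unfold_locales (rule d_hom)

lemma boundaries_subgroup: "subgroup (d ` carrier G) G"
  by (rule d.img_is_subgroup)

lemma boundary_imp_cycle: "d ` carrier G \<subseteq> kernel G G d"
  by (auto simp: kernel_def d_d)

lemma carrier_homology: "carrier (cx_homology G d) = cx_class G d ` kernel G G d"
  by (auto simp: cx_homology_def cx_class_def FactGroup_def RCOSETS_def r_coset_def)

lemma one_homology: "\<one>\<^bsub>cx_homology G d\<^esub> = d ` carrier G"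
  by (simp add: cx_homology_def FactGroup_def)

lemma mem_cx_class_iff:
  assumes "x \<in> carrier G"
  shows "y \<in> cx_class G d x \<longleftrightarrow> y \<in> carrier G \<and> y \<otimes> inv x \<in> d ` carrier G"
proof
  assume "y \<in> cx_class G d x"
  then show "y \<in> carrier G \<and> y \<otimes> inv x \<in> d ` carrier G"
    using assms by (auto simp: cx_class_def r_coset_def m_assoc)
next
  assume *: "y \<in> carrier G \<and> y \<otimes> inv x \<in> d ` carrier G"
  then have "y = y \<otimes> inv x \<otimes> x"
    using assms by (simp add: m_assoc)
  with * show "y \<in> cx_class G d x"
    unfolding cx_class_def r_coset_def by blast
qed

lemma cx_class_eq_iff:
  assumes "x \<in> carrier G" "y \<in> carrier G"
  shows "cx_class G d x = cx_class G d y \<longleftrightarrow> x \<otimes> inv y \<in> d ` carrier G"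
proof
  assume "cx_class G d x = cx_class G d y"
  then have "x \<in> cx_class G d y"
    using rcos_self[OF assms(1) boundaries_subgroup] by (simp add: cx_class_def)
  then show "x \<otimes> inv y \<in> d ` carrier G"
    using assms by (simp add: mem_cx_class_iff)
next
  assume "x \<otimes> inv y \<in> d ` carrier G"
  then have "x \<in> cx_class G d y"
    using assms by (simp add: mem_cx_class_iff)
  then show "cx_class G d x = cx_class G d y"
    using repr_independence[OF _ assms(2) boundaries_subgroup] by (simp add: cx_class_def)
qed

lemma cx_class_eq_one_iff:
  assumes "x \<in> carrier G"
  shows "cx_class G d x = d ` carrier G \<longleftrightarrow> x \<in> d ` carrier G"
  using coset_join1[OF _ assms boundaries_subgroup] coset_join2[OF assms boundaries_subgroup]
  by (auto simp: cx_class_def)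

lemma mult_homology:
  assumes "x \<in> carrier G" "y \<in> carrier G"
  shows "cx_class G d x \<otimes>\<^bsub>cx_homology G d\<^esub> cx_class G d y = cx_class G d (x \<otimes> y)"
proof -
  interpret normal "d ` carrier G" G
    by (rule subgroup_imp_normal[OF boundaries_subgroup])
  show ?thesis
    using rcos_sum[OF assms] by (simp add: cx_homology_def cx_class_def FactGroup_def)
qed

lemma mem_homology:
  assumes "c \<in> carrier (cx_homology G d)" "x \<in> c"
  shows "x \<in> kernel G G d" "cx_class G d x = c"
proof -
  obtain y where y: "y \<in> kernel G G d" "c = cx_class G d y"
    using assms(1) by (auto simp: carrier_homology)
  then have yG: "y \<in> carrier G"
    by (simp add: kernel_def)
  obtain b where b: "b \<in> carrier G" "x = d b \<otimes> y"
    using assms(2) unfolding y(2) by (auto simp: cx_class_def r_coset_def)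
  then show "x \<in> kernel G G d"
    using y(1) by (auto simp: kernel_def d_d)
  show "cx_class G d x = c"
    using assms(2) yG unfolding y(2) cx_class_def
    by (metis repr_independence boundaries_subgroup)
qed

lemma homology_representative:
  assumes "c \<in> carrier (cx_homology G d)"
  shows "(SOME x. x \<in> c) \<in> c" "(SOME x. x \<in> c) \<in> kernel G G d" "cx_class G d (SOME x. x \<in> c) = c"
proof -
  obtain y where y: "y \<in> carrier G" "c = cx_class G d y"
    using assms by (auto simp: carrier_homology kernel_def)
  then have "y \<in> c"
    using rcos_self[OF y(1) boundaries_subgroup] by (simp add: cx_class_def)
  then show *: "(SOME x. x \<in> c) \<in> c"
    by (rule someI)
  show "(SOME x. x \<in> c) \<in> kernel G G d" "cx_class G d (SOME x. x \<in> c) = c"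
    using mem_homology[OF assms *] by auto
qed

lemma comm_group_homology: "comm_group (cx_homology G d)"
proof -
  let ?Z = "G\<lparr>carrier := kernel G G d\<rparr>"
  have Z: "subgroup (kernel G G d) G"
    by (rule d.subgroup_kernel)
  interpret Z: group ?Z
    using subgroup_imp_group[OF Z] .
  interpret Z: comm_group ?Z
    by (rule Z.group_comm_groupI) (auto simp: kernel_def m_comm)
  show ?thesis
    unfolding cx_homology_def
    by (intro Z.abelian_FactGroup subgroup_incl[OF boundaries_subgroup Z boundary_imp_cycle])
qed

end

lemma comm_group_dual:
  assumes "group G"
  shows "comm_group (dual_group G)"
proof -
  interpret group G by fact
  show ?thesis
  proof (rule comm_groupI)
    fix f assume f: "f \<in> carrier (dual_group G)"
    then have "(\<lambda>x\<in>carrier G. - f x) \<in> carrier (dual_group G)"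
      by (auto simp: dual_group_def hom_def integer_group_def)
    then show "\<exists>g\<in>carrier (dual_group G). g \<otimes>\<^bsub>dual_group G\<^esub> f = \<one>\<^bsub>dual_group G\<^esub>"
      by (rule rev_bexI) (auto simp: dual_group_def)
  qed (auto simp: dual_group_def hom_def integer_group_def extensional_def fun_eq_iff)
qed

section \<open>Free complexes of finite rank\<close>

lemma keys_diff_subset:
  "Poly_Mapping.keys x \<subseteq> S \<Longrightarrow> Poly_Mapping.keys y \<subseteq> S \<Longrightarrow> Poly_Mapping.keys (x - y) \<subseteq> S"
  using keys_diff[of x y] by blast

lemma keys_add_subset:
  "Poly_Mapping.keys x \<subseteq> S \<Longrightarrow> Poly_Mapping.keys y \<subseteq> S \<Longrightarrow> Poly_Mapping.keys (x + y) \<subseteq> S"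
  using Poly_Mapping.keys_add[of x y] by blast

lemma frag_extend_frag_of: "frag_extend frag_of x = x"
  using frag_expansion[of x] by simp

lemma frag_cmul_diff_distrib2: "frag_cmul k (x - y) = frag_cmul k x - frag_cmul k y"
  by (rule poly_mapping_eqI) (simp add: lookup_minus algebra_simps)

lemma frag_extend_scaled: "frag_extend (\<lambda>a. frag_cmul k (f a)) x = frag_cmul k (frag_extend f x)"
  by (induction x rule: frag_induct) (auto simp: frag_extend_diff frag_cmul_diff_distrib2)

lemma hom_frag_keys:
  "h \<in> hom (free_Abelian_group S) (free_Abelian_group T) \<Longrightarrow> Poly_Mapping.keys x \<subseteq> S \<Longrightarrow>
   Poly_Mapping.keys (h x) \<subseteq> T"
  by (metis carrier_free_Abelian_group_iff hom_in_carrier)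

lemma hom_int_add:
  "f \<in> hom (free_Abelian_group S) integer_group \<Longrightarrow> Poly_Mapping.keys x \<subseteq> S \<Longrightarrow> Poly_Mapping.keys y \<subseteq> S \<Longrightarrow>
   f (x + y) = f x + f y"
  by (auto simp: hom_def)

lemma hom_int_zero: "f \<in> hom (free_Abelian_group S) integer_group \<Longrightarrow> f 0 = 0"
  using hom_int_add[of f S 0 0] by simp

lemma hom_int_diff:
  assumes "f \<in> hom (free_Abelian_group S) integer_group" "Poly_Mapping.keys x \<subseteq> S" "Poly_Mapping.keys y \<subseteq> S"
  shows "f (x - y) = f x - f y"
  using hom_int_add[OF assms(1) keys_diff_subset[OF assms(2,3)] assms(3)] by simp

lemma hom_int_cmul:
  assumes f: "f \<in> hom (free_Abelian_group S) integer_group" and x: "Poly_Mapping.keys x \<subseteq> S"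
  shows "f (frag_cmul n x) = n * f x"
proof -
  have k: "Poly_Mapping.keys (frag_cmul n x) \<subseteq> S" for n
    using x keys_cmul by blast
  show ?thesis
  proof (induction n rule: int_induct[where k = 0])
    case base
    then show ?case
      using hom_int_zero[OF f] by simp
  next
    case (step1 i)
    then show ?case
      using hom_int_add[OF f k[of i] x] by (simp add: frag_cmul_distrib algebra_simps)
  next
    case (step2 i)
    then show ?case
      using hom_int_diff[OF f k[of i] x] by (simp add: frag_cmul_diff_distrib algebra_simps)
  qed
qed

text \<open>The image is a subgroup of \<open>\<int>\<close>, so it is generated by its least positive element, or by \<open>0\<close>.\<close>

lemma hom_int_image_principal:
  assumes g: "g \<in> hom (free_Abelian_group S) integer_group"
  obtains a where "Poly_Mapping.keys a \<subseteq> S" "\<And>x. Poly_Mapping.keys x \<subseteq> S \<Longrightarrow> g a dvd g x"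
proof (cases "\<exists>x. Poly_Mapping.keys x \<subseteq> S \<and> g x \<noteq> 0")
  case True
  then obtain x where x: "Poly_Mapping.keys x \<subseteq> S" "g x \<noteq> 0"
    by blast
  let ?P = "\<lambda>n. 0 < n \<and> (\<exists>a. Poly_Mapping.keys a \<subseteq> S \<and> g a = int n)"
  have neg: "Poly_Mapping.keys (- x) \<subseteq> S" "g (- x) = - g x"
    using hom_int_diff[OF g _ x(1), of 0] hom_int_zero[OF g] x(1) by auto
  have "\<exists>n. ?P n"
  proof (cases "g x > 0")
    case True
    then show ?thesis
      using x by (intro exI[of _ "nat (g x)"]) auto
  next
    case False
    then show ?thesis
      using x neg by (intro exI[of _ "nat (g (- x))"] conjI exI[of _ "- x"]) auto
  qed
  define n where "n = (LEAST n. ?P n)"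
  have "?P n"
    unfolding n_def using LeastI_ex[OF \<open>\<exists>n. ?P n\<close>] .
  then obtain a where a: "Poly_Mapping.keys a \<subseteq> S" "g a = int n" "n > 0"
    by blast
  have "g a dvd g y" if y: "Poly_Mapping.keys y \<subseteq> S" for y
  proof (rule ccontr)
    assume nd: "\<not> g a dvd g y"
    let ?q = "frag_cmul (g y div g a) a"
    have q: "Poly_Mapping.keys ?q \<subseteq> S"
      using a(1) keys_cmul by blast
    have "g (y - ?q) = g y mod g a"
      using hom_int_diff[OF g y q] hom_int_cmul[OF g a(1)] by (simp add: minus_div_mult_eq_mod)
    moreover have "g y mod g a \<noteq> 0" "0 \<le> g y mod g a" "g y mod g a < int n"
      using nd a pos_mod_sign[of "g a" "g y"] pos_mod_bound[of "g a" "g y"] by (simp_all add: dvd_eq_mod_eq_0)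
    ultimately have "?P (nat (g y mod g a))" "nat (g y mod g a) < n"
      using keys_diff_subset[OF y q] by auto
    then show False
      using not_less_Least[of "nat (g y mod g a)" ?P] unfolding n_def by blast
  qed
  with a(1) that show thesis by blast
next
  case False
  then show ?thesis
    using that[of 0] by auto
qed

text \<open>Induction on the number of functionals. To pass from a retraction \<open>r\<close> to the kernel of one more
  functional \<open>\<phi>\<close>, choose \<open>a\<close> such that \<open>\<phi> (r a)\<close> generates the image of \<open>\<phi> \<circ> r\<close> and subtract from \<open>r x\<close> the
  multiple of \<open>r a\<close> with the same value under \<open>\<phi>\<close>. The cycles of a complex of finite rank are such
  a common kernel, the functionals being the coordinates of the differential.\<close>

lemma retraction_onto_common_kernel:
  assumes "finite T"
    and "\<And>t. t \<in> T \<Longrightarrow> \<phi> t \<in> hom (free_Abelian_group S) integer_group"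
  obtains r where "r \<in> hom (free_Abelian_group S) (free_Abelian_group S)"
    "\<And>x t. Poly_Mapping.keys x \<subseteq> S \<Longrightarrow> t \<in> T \<Longrightarrow> \<phi> t (r x) = 0"
    "\<And>x. Poly_Mapping.keys x \<subseteq> S \<Longrightarrow> (\<And>t. t \<in> T \<Longrightarrow> \<phi> t x = 0) \<Longrightarrow> r x = x"
  using assms
proof (induction T arbitrary: thesis rule: finite_induct)
  case empty
  show ?case
    by (rule empty(1)[of "\<lambda>x. x"]) (auto simp: hom_def dest!: subsetD[OF Poly_Mapping.keys_add])
next
  case (insert t T)
  obtain r where r: "r \<in> hom (free_Abelian_group S) (free_Abelian_group S)"
    "\<And>x t. Poly_Mapping.keys x \<subseteq> S \<Longrightarrow> t \<in> T \<Longrightarrow> \<phi> t (r x) = 0"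
    "\<And>x. Poly_Mapping.keys x \<subseteq> S \<Longrightarrow> (\<And>t. t \<in> T \<Longrightarrow> \<phi> t x = 0) \<Longrightarrow> r x = x"
    using insert.IH insert.prems(2) by blast
  have rk: "Poly_Mapping.keys (r x) \<subseteq> S" if "Poly_Mapping.keys x \<subseteq> S" for x
    using hom_frag_keys[OF r(1) that] .
  have \<phi>: "\<phi> u \<in> hom (free_Abelian_group S) integer_group" if "u \<in> insert t T" for u
    using insert.prems(2) that by blast
  have g: "(\<lambda>x. \<phi> t (r x)) \<in> hom (free_Abelian_group S) integer_group"
    using hom_compose[OF r(1) \<phi>[of t]] by (simp add: o_def)
  obtain a where a: "Poly_Mapping.keys a \<subseteq> S"
    and dvd: "\<And>x. Poly_Mapping.keys x \<subseteq> S \<Longrightarrow> \<phi> t (r a) dvd \<phi> t (r x)"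
    using hom_int_image_principal[OF g] by blast
  \<comment> \<open>If \<open>\<phi> t (r a)\<close> is \<open>0\<close>, then so is \<open>\<phi> t (r x)\<close>, and the quotient is \<open>0\<close> as it should be.\<close>
  define r' where "r' = (\<lambda>x. r x - frag_cmul (\<phi> t (r x) div \<phi> t (r a)) (r a))"
  have ck: "Poly_Mapping.keys (frag_cmul n (r a)) \<subseteq> S" for n
    using rk[OF a] keys_cmul by blast
  have add: "r' (x + y) = r' x + r' y" if "Poly_Mapping.keys x \<subseteq> S" "Poly_Mapping.keys y \<subseteq> S" for x y
    using dvd[OF that(1)] hom_int_add[OF g that] hom_frag_add[OF r(1) that]
    by (simp add: r'_def div_plus_div_distrib_dvd_left frag_cmul_distrib)
  have k': "Poly_Mapping.keys (r' x) \<subseteq> S" if "Poly_Mapping.keys x \<subseteq> S" for x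
    unfolding r'_def by (rule keys_diff_subset[OF rk[OF that] ck])
  have \<phi>': "\<phi> u (r' x) = \<phi> u (r x) - (\<phi> t (r x) div \<phi> t (r a)) * \<phi> u (r a)"
    if "Poly_Mapping.keys x \<subseteq> S" "u \<in> insert t T" for x u
    unfolding r'_def
    using hom_int_diff[OF \<phi>[OF that(2)] rk[OF that(1)] ck] hom_int_cmul[OF \<phi>[OF that(2)] rk[OF a]] by simp
  show ?case
  proof (rule insert.prems(1)[of r'])
    show "r' \<in> hom (free_Abelian_group S) (free_Abelian_group S)"
      using add k' by (auto simp: hom_def)
    show "\<phi> u (r' x) = 0" if "Poly_Mapping.keys x \<subseteq> S" "u \<in> insert t T" for x u
      using \<phi>'[OF that] r(2)[OF that(1)] r(2)[OF a] dvd[OF that(1)] that(2) by auto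
    show "r' x = x" if "Poly_Mapping.keys x \<subseteq> S" "\<And>u. u \<in> insert t T \<Longrightarrow> \<phi> u x = 0" for x
    proof -
      have "r x = x"
        using r(3) that by simp
      then show ?thesis
        using that(2)[of t] by (simp add: r'_def)
    qed
  qed
qed

locale free_complex =
  fixes S :: "'a set" and \<delta> :: "'a \<Rightarrow> ('a \<Rightarrow>\<^sub>0 int)"
  assumes finite_basis: "finite S"
    and keys_d: "s \<in> S \<Longrightarrow> Poly_Mapping.keys (\<delta> s) \<subseteq> S"
    and d_d_basis: "s \<in> S \<Longrightarrow> frag_extend \<delta> (\<delta> s) = 0"
begin

abbreviation F where "F \<equiv> free_Abelian_group S"

lemma keys_boundary: "Poly_Mapping.keys x \<subseteq> S \<Longrightarrow> Poly_Mapping.keys (frag_extend \<delta> x) \<subseteq> S"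
  using keys_frag_extend[of \<delta> x] keys_d by blast

lemma boundary_hom: "frag_extend \<delta> \<in> hom F F"
  by (auto simp: hom_def frag_extend_add dest: subsetD[OF keys_boundary])

lemma boundary_boundary:
  "Poly_Mapping.keys x \<subseteq> S \<Longrightarrow> frag_extend \<delta> (frag_extend \<delta> x) = 0"
  by (induction x rule: frag_induction) (auto simp: d_d_basis frag_extend_diff)

sublocale differential_group F "frag_extend \<delta>"
proof -
  interpret comm_group F
    by (rule abelian_free_Abelian_group)
  show "differential_group F (frag_extend \<delta>)"
    by unfold_locales (use boundary_hom boundary_boundary in auto)
qed

lemma mem_cycles_iff: "x \<in> kernel F F (frag_extend \<delta>) \<longleftrightarrow> Poly_Mapping.keys x \<subseteq> S \<and> frag_extend \<delta> x = 0"
  by (auto simp: kernel_def)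

lemma cx_class_frag_eq_iff:
  assumes "Poly_Mapping.keys x \<subseteq> S" "Poly_Mapping.keys y \<subseteq> S"
  shows "cx_class F (frag_extend \<delta>) x = cx_class F (frag_extend \<delta>) y \<longleftrightarrow> x - y \<in> frag_extend \<delta> ` carrier F"
  using assms cx_class_eq_iff[of x y] by simp

lemma retraction_onto_cycles:
  obtains r where "r \<in> hom F F" "\<And>x. Poly_Mapping.keys x \<subseteq> S \<Longrightarrow> frag_extend \<delta> (r x) = 0"
    "\<And>x. x \<in> kernel F F (frag_extend \<delta>) \<Longrightarrow> r x = x"
proof -
  let ?\<phi> = "\<lambda>t x. Poly_Mapping.lookup (frag_extend \<delta> x) t"
  obtain r where r: "r \<in> hom F F"
    "\<And>x t. Poly_Mapping.keys x \<subseteq> S \<Longrightarrow> t \<in> S \<Longrightarrow> ?\<phi> t (r x) = 0"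
    "\<And>x. Poly_Mapping.keys x \<subseteq> S \<Longrightarrow> (\<And>t. t \<in> S \<Longrightarrow> ?\<phi> t x = 0) \<Longrightarrow> r x = x"
    by (rule retraction_onto_common_kernel[OF finite_basis, of ?\<phi>])
      (auto simp: hom_def frag_extend_add lookup_add)
  have "frag_extend \<delta> (r x) = 0" if "Poly_Mapping.keys x \<subseteq> S" for x
  proof (rule poly_mapping_eqI)
    fix t
    have "Poly_Mapping.keys (frag_extend \<delta> (r x)) \<subseteq> S"
      by (intro keys_boundary hom_frag_keys[OF r(1) that])
    then show "?\<phi> t (r x) = Poly_Mapping.lookup 0 t"
      using r(2)[OF that] by (cases "t \<in> S") (auto simp: in_keys_iff)
  qed
  with r(1,3) that show thesis
    by (simp add: mem_cycles_iff)
qed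

text \<open>A chain map from the complex to its homology, the latter with zero differential, that is the identity
  on homology: compose the retraction onto the cycles with the passage to classes.\<close>

lemma homology_projection:
  obtains \<phi> where "\<phi> \<in> hom F (cx_homology F (frag_extend \<delta>))"
    "\<And>x. x \<in> kernel F F (frag_extend \<delta>) \<Longrightarrow> \<phi> x = cx_class F (frag_extend \<delta>) x"
    "\<And>x. Poly_Mapping.keys x \<subseteq> S \<Longrightarrow> \<phi> (frag_extend \<delta> x) = \<one>\<^bsub>cx_homology F (frag_extend \<delta>)\<^esub>"
proof -
  obtain r where r: "r \<in> hom F F" "\<And>x. Poly_Mapping.keys x \<subseteq> S \<Longrightarrow> frag_extend \<delta> (r x) = 0"
    "\<And>x. x \<in> kernel F F (frag_extend \<delta>) \<Longrightarrow> r x = x"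
    using retraction_onto_cycles by blast
  have rk: "Poly_Mapping.keys (r x) \<subseteq> S" if "Poly_Mapping.keys x \<subseteq> S" for x
    using hom_frag_keys[OF r(1) that] .
  show thesis
  proof (rule that[of "\<lambda>x. cx_class F (frag_extend \<delta>) (r x)"])
    show "(\<lambda>x. cx_class F (frag_extend \<delta>) (r x)) \<in> hom F (cx_homology F (frag_extend \<delta>))"
      using r(2) rk hom_frag_add[OF r(1)]
      by (auto simp: hom_def carrier_homology mem_cycles_iff mult_homology)
    show "cx_class F (frag_extend \<delta>) (r x) = cx_class F (frag_extend \<delta>) x"
      if "x \<in> kernel F F (frag_extend \<delta>)" for x
      using r(3)[OF that] by simp
    show "cx_class F (frag_extend \<delta>) (r (frag_extend \<delta> x)) = \<one>\<^bsub>cx_homology F (frag_extend \<delta>)\<^esub>"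
      if "Poly_Mapping.keys x \<subseteq> S" for x
      using that keys_boundary[OF that] boundary_boundary[OF that] r(3)[of "frag_extend \<delta> x"]
      by (subst one_homology, subst cx_class_eq_one_iff) (auto simp: mem_cycles_iff)
  qed
qed

text \<open>A basis of the homology lifts to cycles, and this gives a section \<open>frag_extend z\<close> of the projection from cycles to
  homology. Retract a chain onto the cycles and subtract the lift of its class.\<close>

lemma retraction_onto_boundaries:
  assumes "free_abelian (cx_homology F (frag_extend \<delta>))"
  obtains \<rho> where "\<rho> \<in> hom F F" "\<And>x. Poly_Mapping.keys x \<subseteq> S \<Longrightarrow> \<rho> x \<in> frag_extend \<delta> ` carrier F"
    "\<And>x. Poly_Mapping.keys x \<subseteq> S \<Longrightarrow> \<rho> (frag_extend \<delta> x) = frag_extend \<delta> x"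
proof -
  let ?H = "cx_homology F (frag_extend \<delta>)" and ?cls = "cx_class F (frag_extend \<delta>)"
  obtain B :: "('a \<Rightarrow>\<^sub>0 int) set set" and h where h: "h \<in> iso ?H (free_Abelian_group B)"
    using assms unfolding free_abelian_def is_iso_def by blast
  interpret H: comm_group ?H
    by (rule comm_group_homology)
  interpret h: group_hom ?H "free_Abelian_group B" h
    using h by (intro group_hom.intro group_hom_axioms.intro) (auto simp: iso_def H.is_group)
  obtain \<phi> where \<phi>: "\<phi> \<in> hom F ?H" "\<And>x. x \<in> kernel F F (frag_extend \<delta>) \<Longrightarrow> \<phi> x = ?cls x"
    "\<And>x. Poly_Mapping.keys x \<subseteq> S \<Longrightarrow> \<phi> (frag_extend \<delta> x) = \<one>\<^bsub>?H\<^esub>"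
    using homology_projection by blast
  obtain r where r: "r \<in> hom F F" "\<And>x. Poly_Mapping.keys x \<subseteq> S \<Longrightarrow> frag_extend \<delta> (r x) = 0"
    "\<And>x. x \<in> kernel F F (frag_extend \<delta>) \<Longrightarrow> r x = x"
    using retraction_onto_cycles by blast
  have "\<exists>z. z \<in> kernel F F (frag_extend \<delta>) \<and> h (?cls z) = frag_of b" if "b \<in> B" for b
  proof -
    have "frag_of b \<in> h ` carrier ?H"
      using h that by (auto simp: iso_def bij_betw_def)
    then show ?thesis
      by (auto simp: carrier_homology)
  qed
  then obtain z where z: "\<And>b. b \<in> B \<Longrightarrow> z b \<in> kernel F F (frag_extend \<delta>)"
    "\<And>b. b \<in> B \<Longrightarrow> h (?cls (z b)) = frag_of b"
    by metis
  have ze: "frag_extend z y \<in> kernel F F (frag_extend \<delta>) \<and> h (?cls (frag_extend z y)) = y"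
    if "Poly_Mapping.keys y \<subseteq> B" for y
    using that
  proof (induction y rule: frag_induct_on)
    case zero
    have "?cls 0 = \<one>\<^bsub>?H\<^esub>"
      using cx_class_eq_one_iff[of 0] one_homology by (force intro: image_eqI[of _ _ 0])
    then show ?case
      using h.hom_one by (simp add: mem_cycles_iff)
  next
    case (diff x y)
    let ?x = "frag_extend z x" and ?y = "frag_extend z y"
    have d: "?x - ?y \<in> kernel F F (frag_extend \<delta>)"
      using diff by (simp add: mem_cycles_iff frag_extend_diff keys_diff_subset)
    have "?cls (?x - ?y) \<otimes>\<^bsub>?H\<^esub> ?cls ?y = ?cls ?x"
      using diff d by (subst mult_homology) (auto simp: mem_cycles_iff)
    then have "h (?cls (?x - ?y)) + y = x"
      using h.hom_mult[of "?cls (?x - ?y)" "?cls ?y"] diff d by (simp add: carrier_homology)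
    then show ?case
      using d by (simp add: frag_extend_diff algebra_simps)
  next
    case (basis b)
    then show ?case
      using z by simp
  qed
  \<comment> \<open>On a boundary \<open>r\<close> is the identity and the class is trivial, so nothing is subtracted.\<close>
  define \<rho> where "\<rho> = (\<lambda>x. r x - frag_extend z (h (?cls (r x))))"
  have rk: "r x \<in> kernel F F (frag_extend \<delta>)" if "Poly_Mapping.keys x \<subseteq> S" for x
    using hom_frag_keys[OF r(1) that] r(2)[OF that] by (simp add: mem_cycles_iff)
  have hk: "Poly_Mapping.keys (h (?cls (r x))) \<subseteq> B" if "Poly_Mapping.keys x \<subseteq> S" for x
    using h.hom_closed[of "?cls (r x)"] rk[OF that] by (auto simp: carrier_homology)
  have bd: "\<rho> x \<in> frag_extend \<delta> ` carrier F" if x: "Poly_Mapping.keys x \<subseteq> S" for x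
  proof -
    let ?y = "frag_extend z (h (?cls (r x)))"
    have y: "?y \<in> kernel F F (frag_extend \<delta>)" "h (?cls ?y) = h (?cls (r x))"
      using ze[OF hk[OF x]] by auto
    then have "?cls (r x) = ?cls ?y"
      using h rk[OF x] by (auto simp: iso_def bij_betw_def inj_on_def carrier_homology)
    then show ?thesis
      using y rk[OF x] by (subst (asm) cx_class_frag_eq_iff) (auto simp: mem_cycles_iff \<rho>_def)
  qed
  show thesis
  proof (rule that[of \<rho>])
    show "\<rho> x \<in> frag_extend \<delta> ` carrier F" if "Poly_Mapping.keys x \<subseteq> S" for x
      by (rule bd[OF that])
    have add: "\<rho> (x + y) = \<rho> x + \<rho> y" if x: "Poly_Mapping.keys x \<subseteq> S" and y: "Poly_Mapping.keys y \<subseteq> S" for x y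
    proof -
      have "?cls (r x + r y) = ?cls (r x) \<otimes>\<^bsub>?H\<^esub> ?cls (r y)"
        using rk[OF x] rk[OF y] by (subst mult_homology) (auto simp: mem_cycles_iff)
      then have "h (?cls (r (x + y))) = h (?cls (r x)) + h (?cls (r y))"
        using h.hom_mult[of "?cls (r x)" "?cls (r y)"] rk[OF x] rk[OF y] hom_frag_add[OF r(1) x y]
        by (simp add: carrier_homology)
      then show ?thesis
        using hom_frag_add[OF r(1) x y] by (simp add: \<rho>_def frag_extend_add)
    qed
    show "\<rho> \<in> hom F F"
    proof -
      have "Poly_Mapping.keys (\<rho> x) \<subseteq> S" if "Poly_Mapping.keys x \<subseteq> S" for x
        using bd[OF that] keys_boundary by (metis carrier_free_Abelian_group_iff imageE)
      with add show ?thesis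
        by (auto simp: hom_def)
    qed
    show "\<rho> (frag_extend \<delta> x) = frag_extend \<delta> x" if x: "Poly_Mapping.keys x \<subseteq> S" for x
    proof -
      have "r (frag_extend \<delta> x) = frag_extend \<delta> x"
        using boundary_boundary[OF x] keys_boundary[OF x] by (intro r(3)) (simp add: mem_cycles_iff)
      moreover have "?cls (frag_extend \<delta> x) = \<one>\<^bsub>?H\<^esub>"
        using x keys_boundary[OF x] by (subst one_homology, subst cx_class_eq_one_iff) auto
      ultimately show ?thesis
        using h.hom_one by (simp add: \<rho>_def)
    qed
  qed
qed

text \<open>Such an \<open>f\<close> has the form \<open>f y = g (d y)\<close> with \<open>g\<close> defined on boundaries only; the retraction onto the boundaries
  extends \<open>g\<close> to all chains.\<close>

lemma cocycle_vanishing_on_cycles: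
  assumes free: "free_abelian (cx_homology F (frag_extend \<delta>))"
    and f: "f \<in> hom F integer_group" "\<And>x. x \<in> kernel F F (frag_extend \<delta>) \<Longrightarrow> f x = 0"
  obtains g where "g \<in> hom F integer_group" "\<And>x. Poly_Mapping.keys x \<subseteq> S \<Longrightarrow> g (frag_extend \<delta> x) = f x"
proof -
  obtain \<rho> where \<rho>: "\<rho> \<in> hom F F" "\<And>x. Poly_Mapping.keys x \<subseteq> S \<Longrightarrow> \<rho> x \<in> frag_extend \<delta> ` carrier F"
    "\<And>x. Poly_Mapping.keys x \<subseteq> S \<Longrightarrow> \<rho> (frag_extend \<delta> x) = frag_extend \<delta> x"
    using retraction_onto_boundaries[OF free] by blast
  \<comment> \<open>\<open>f\<close> takes the same value on any two chains with the same boundary, so the choice of \<open>c x\<close> is immaterial.\<close>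
  define c where "c = (\<lambda>x. SOME y. Poly_Mapping.keys y \<subseteq> S \<and> frag_extend \<delta> y = \<rho> x)"
  have c: "Poly_Mapping.keys (c x) \<subseteq> S" "frag_extend \<delta> (c x) = \<rho> x" if "Poly_Mapping.keys x \<subseteq> S" for x
  proof -
    have "\<rho> x \<in> frag_extend \<delta> ` carrier F"
      by (rule \<rho>(2)[OF that])
    then obtain y where "\<rho> x = frag_extend \<delta> y" "y \<in> carrier F"
      by (rule imageE)
    then have "\<exists>y. Poly_Mapping.keys y \<subseteq> S \<and> frag_extend \<delta> y = \<rho> x"
      by (intro exI[of _ y]) simp
    from someI_ex[OF this] show "Poly_Mapping.keys (c x) \<subseteq> S" "frag_extend \<delta> (c x) = \<rho> x"
      by (auto simp: c_def)
  qed
  have indep: "f y = f y'" if "Poly_Mapping.keys y \<subseteq> S" "Poly_Mapping.keys y' \<subseteq> S"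
    "frag_extend \<delta> y = frag_extend \<delta> y'" for y y'
    using f(2)[of "y - y'"] that hom_int_diff[OF f(1) that(1,2)]
    by (simp add: mem_cycles_iff keys_diff_subset frag_extend_diff)
  show thesis
  proof (rule that[of "\<lambda>x. f (c x)"])
    have "f (c (x + y)) = f (c x) + f (c y)" if x: "Poly_Mapping.keys x \<subseteq> S" and y: "Poly_Mapping.keys y \<subseteq> S" for x y
    proof -
      have "f (c (x + y)) = f (c x + c y)"
        using c[OF x] c[OF y] c[OF keys_add_subset[OF x y]] hom_frag_add[OF \<rho>(1) x y]
        by (intro indep) (auto simp: frag_extend_add keys_add_subset)
      then show ?thesis
        using hom_int_add[OF f(1) c(1)[OF x] c(1)[OF y]] by simp
    qed
    then show "(\<lambda>x. f (c x)) \<in> hom F integer_group"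
      by (auto simp: hom_def)
    show "f (c (frag_extend \<delta> x)) = f x" if x: "Poly_Mapping.keys x \<subseteq> S" for x
      using c[OF keys_boundary[OF x]] \<rho>(3)[OF x] x by (intro indep) auto
  qed
qed

text \<open>Extension of \<open>f\<close> by zero to the complementary summand reduces this to the whole complex, to whose
  homology the freeness refers.\<close>

lemma cocycle_vanishing_on_cycles_summand:
  assumes free: "free_abelian (cx_homology F (frag_extend \<delta>))"
    and S0: "S0 \<subseteq> S" "\<And>s. s \<in> S0 \<Longrightarrow> Poly_Mapping.keys (\<delta> s) \<subseteq> S0"
      "\<And>s. s \<in> S - S0 \<Longrightarrow> Poly_Mapping.keys (\<delta> s) \<subseteq> S - S0"
    and f: "f \<in> hom (free_Abelian_group S0) integer_group"
      "\<And>x. Poly_Mapping.keys x \<subseteq> S0 \<Longrightarrow> frag_extend \<delta> x = 0 \<Longrightarrow> f x = 0"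
  obtains g where "g \<in> hom (free_Abelian_group S0) integer_group"
    "\<And>x. Poly_Mapping.keys x \<subseteq> S0 \<Longrightarrow> g (frag_extend \<delta> x) = f x"
proof -
  define p :: "('a \<Rightarrow>\<^sub>0 int) \<Rightarrow> ('a \<Rightarrow>\<^sub>0 int)" where "p = frag_extend (\<lambda>s. if s \<in> S0 then frag_of s else 0)"
  have pk: "Poly_Mapping.keys (p x) \<subseteq> S0" for x
    unfolding p_def by (rule subset_trans[OF keys_frag_extend]) (auto simp: keys_frag_of split: if_splits)
  have p_id: "p x = x" if "Poly_Mapping.keys x \<subseteq> S0" for x
    using that by (induction rule: frag_induct_on) (auto simp: p_def frag_extend_diff)
  have p0: "p x = 0" if "Poly_Mapping.keys x \<subseteq> S - S0" for x
    using that by (induction rule: frag_induct_on) (auto simp: p_def frag_extend_diff)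
  have comm: "frag_extend \<delta> (p x) = p (frag_extend \<delta> x)" if "Poly_Mapping.keys x \<subseteq> S" for x
    using that
  proof (induction rule: frag_induct_on)
    case (basis s)
    show ?case
    proof (cases "s \<in> S0")
      case True
      then show ?thesis
        using p_id[OF S0(2)[OF True]] p_id[of "frag_of s"] by (simp add: keys_frag_of)
    next
      case False
      then show ?thesis
        using p0[of "\<delta> s"] p0[of "frag_of s"] S0(3)[of s] basis by (simp add: keys_frag_of)
    qed
  qed (auto simp: p_def frag_extend_diff)
  have "(\<lambda>x. f (p x)) \<in> hom F integer_group"
    using hom_int_add[OF f(1) pk pk] by (auto simp: hom_def p_def frag_extend_add)
  moreover have "f (p x) = 0" if "x \<in> kernel F F (frag_extend \<delta>)" for x
    using that comm[of x] by (intro f(2)[OF pk]) (simp add: mem_cycles_iff, simp add: p_def)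
  ultimately obtain g where g: "g \<in> hom F integer_group"
    "\<And>x. Poly_Mapping.keys x \<subseteq> S \<Longrightarrow> g (frag_extend \<delta> x) = f (p x)"
    using cocycle_vanishing_on_cycles[OF free, of "\<lambda>x. f (p x)"] by blast
  show thesis
  proof (rule that[of g])
    show "g \<in> hom (free_Abelian_group S0) integer_group"
      using g(1) S0(1) by (auto simp: hom_def)
    show "g (frag_extend \<delta> x) = f x" if "Poly_Mapping.keys x \<subseteq> S0" for x
      using g(2)[of x] p_id[OF that] that S0(1) by auto
  qed
qed

section \<open>Evaluation of cohomology on homology\<close>

definition codifferential :: "(('a \<Rightarrow>\<^sub>0 int) \<Rightarrow> int) \<Rightarrow> (('a \<Rightarrow>\<^sub>0 int) \<Rightarrow> int)" where
  "codifferential f = (\<lambda>x\<in>carrier F. f (frag_extend \<delta> x))"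

lemma carrier_dual_iff: "f \<in> carrier (dual_group F) \<longleftrightarrow> f \<in> hom F integer_group \<and> f \<in> extensional (carrier F)"
  by (auto simp: dual_group_def)

lemma codifferential_closed:
  "f \<in> hom F integer_group \<Longrightarrow> codifferential f \<in> carrier (dual_group F)"
  using keys_boundary hom_int_add[of f S]
  by (auto simp: carrier_dual_iff codifferential_def hom_def frag_extend_add keys_add_subset)

sublocale dual: differential_group "dual_group F" codifferential
proof -
  interpret D: comm_group "dual_group F"
    by (rule comm_group_dual) simp
  show "differential_group (dual_group F) codifferential"
  proof
    show "codifferential \<in> hom (dual_group F) (dual_group F)"
      using codifferential_closed keys_boundary
      by (auto simp: hom_def carrier_dual_iff) (auto simp: dual_group_def codifferential_def fun_eq_iff)
    show "codifferential (codifferential f) = \<one>\<^bsub>dual_group F\<^esub>" if "f \<in> carrier (dual_group F)" for f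
      using that keys_boundary boundary_boundary hom_int_zero[of f S]
      by (auto simp: carrier_dual_iff) (auto simp: dual_group_def codifferential_def fun_eq_iff)
  qed
qed

lemma cocycle_iff:
  "f \<in> kernel (dual_group F) (dual_group F) codifferential \<longleftrightarrow>
     f \<in> carrier (dual_group F) \<and> (\<forall>x. Poly_Mapping.keys x \<subseteq> S \<longrightarrow> f (frag_extend \<delta> x) = 0)"
  by (auto simp: kernel_def dual_group_def codifferential_def fun_eq_iff restrict_def)

lemma cohomology_eval_hom:
  assumes a: "a \<in> carrier (cx_homology (dual_group F) codifferential)"
  shows "(\<lambda>c\<in>carrier (cx_homology F (frag_extend \<delta>)). (SOME f. f \<in> a) (SOME x. x \<in> c))
    \<in> hom (cx_homology F (frag_extend \<delta>)) integer_group"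
proof (rule homI)
  let ?H = "cx_homology F (frag_extend \<delta>)" and ?r = "\<lambda>c. SOME x. x \<in> c" and ?f = "SOME f. f \<in> a"
  have f: "?f \<in> hom F integer_group" "\<And>x. Poly_Mapping.keys x \<subseteq> S \<Longrightarrow> ?f (frag_extend \<delta> x) = 0"
    using dual.homology_representative[OF a] by (auto simp: cocycle_iff carrier_dual_iff)
  fix c c' assume c: "c \<in> carrier ?H" "c' \<in> carrier ?H"
  interpret H: comm_group ?H
    by (rule comm_group_homology)
  note r = homology_representative[OF c(1)] homology_representative[OF c(2)]
    homology_representative[OF H.m_closed[OF c]]
  have k: "Poly_Mapping.keys (?r c) \<subseteq> S" "Poly_Mapping.keys (?r c') \<subseteq> S"
    "Poly_Mapping.keys (?r (c \<otimes>\<^bsub>?H\<^esub> c')) \<subseteq> S"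
    using r by (auto simp: mem_cycles_iff)
  have "cx_class F (frag_extend \<delta>) (?r (c \<otimes>\<^bsub>?H\<^esub> c')) = cx_class F (frag_extend \<delta>) (?r c + ?r c')"
    using mult_homology[of "?r c" "?r c'"] r k by simp
  then have "?r (c \<otimes>\<^bsub>?H\<^esub> c') - (?r c + ?r c') \<in> frag_extend \<delta> ` carrier F"
    using k by (subst (asm) cx_class_frag_eq_iff) (simp_all add: keys_add_subset)
  then obtain y where y: "?r (c \<otimes>\<^bsub>?H\<^esub> c') - (?r c + ?r c') = frag_extend \<delta> y" "y \<in> carrier F"
    by (rule imageE)
  have "?f (?r (c \<otimes>\<^bsub>?H\<^esub> c')) - (?f (?r c) + ?f (?r c')) = 0"
    using f(2)[of y] y hom_int_diff[OF f(1) k(3) keys_add_subset[OF k(1,2)]] hom_int_add[OF f(1) k(1,2)] by simp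
  then show "(\<lambda>c\<in>carrier ?H. ?f (?r c)) (c \<otimes>\<^bsub>?H\<^esub> c') =
    (\<lambda>c\<in>carrier ?H. ?f (?r c)) c \<otimes>\<^bsub>integer_group\<^esub> (\<lambda>c\<in>carrier ?H. ?f (?r c)) c'"
    using c by simp
qed simp

text \<open>This is the injectivity part of the universal coefficient theorem; the assumption \<open>ext\<close> takes the place
  of the vanishing of \<open>Ext\<close>.\<close>

lemma cohomology_eval_zero_iff:
  assumes ext: "\<And>f. f \<in> hom F integer_group \<Longrightarrow> (\<And>x. x \<in> kernel F F (frag_extend \<delta>) \<Longrightarrow> f x = 0) \<Longrightarrow>
      \<exists>g\<in>hom F integer_group. \<forall>x. Poly_Mapping.keys x \<subseteq> S \<longrightarrow> g (frag_extend \<delta> x) = f x"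
    and a: "a \<in> carrier (cx_homology (dual_group F) codifferential)"
  shows "(\<lambda>c\<in>carrier (cx_homology F (frag_extend \<delta>)). (SOME f. f \<in> a) (SOME x. x \<in> c)) =
      (\<lambda>c\<in>carrier (cx_homology F (frag_extend \<delta>)). 0) \<longleftrightarrow>
    a = \<one>\<^bsub>cx_homology (dual_group F) codifferential\<^esub>"
proof
  let ?H = "cx_homology F (frag_extend \<delta>)" and ?r = "\<lambda>c. SOME x. x \<in> c" and ?f = "SOME f. f \<in> a"
  note fa = dual.homology_representative[OF a]
  have f: "?f \<in> hom F integer_group" "?f \<in> extensional (carrier F)" "?f \<in> carrier (dual_group F)"
    "\<And>x. Poly_Mapping.keys x \<subseteq> S \<Longrightarrow> ?f (frag_extend \<delta> x) = 0"
    using fa(2) by (auto simp: cocycle_iff carrier_dual_iff)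
  {
    assume eq: "(\<lambda>c\<in>carrier ?H. ?f (?r c)) = (\<lambda>c\<in>carrier ?H. 0)"
    have "?f x = 0" if x: "x \<in> kernel F F (frag_extend \<delta>)" for x
    proof -
      let ?c = "cx_class F (frag_extend \<delta>) x"
      have c: "?c \<in> carrier ?H"
        using x by (simp add: carrier_homology)
      note r = homology_representative[OF c]
      have "x - ?r ?c \<in> frag_extend \<delta> ` carrier F"
        using r x by (subst cx_class_frag_eq_iff[symmetric]) (simp_all add: mem_cycles_iff)
      then obtain y where y: "x - ?r ?c = frag_extend \<delta> y" "y \<in> carrier F"
        by (rule imageE)
      have "?f x - ?f (?r ?c) = 0"
        using f(4)[of y] y hom_int_diff[OF f(1), of x "?r ?c"] x r(2) by (simp add: mem_cycles_iff)
      moreover have "?f (?r ?c) = 0"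
        using fun_cong[OF eq, of ?c] c by simp
      ultimately show ?thesis
        by simp
    qed
    then obtain g where g: "g \<in> hom F integer_group"
      "\<And>x. Poly_Mapping.keys x \<subseteq> S \<Longrightarrow> g (frag_extend \<delta> x) = ?f x"
      using ext[OF f(1)] by blast
    have "restrict g (carrier F) \<in> carrier (dual_group F)"
      using g(1) by (auto simp: carrier_dual_iff hom_def keys_add_subset)
    moreover have "codifferential (restrict g (carrier F)) = ?f"
      using g(2) f(2) keys_boundary
      by (intro extensionalityI[of _ "carrier F"]) (auto simp: codifferential_def)
    ultimately have "?f \<in> codifferential ` carrier (dual_group F)"
      by (metis image_eqI)
    then show "a = \<one>\<^bsub>cx_homology (dual_group F) codifferential\<^esub>"
      using dual.cx_class_eq_one_iff[OF f(3)] fa(3) dual.one_homology by simp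
  }
  assume "a = \<one>\<^bsub>cx_homology (dual_group F) codifferential\<^esub>"
  with fa(1) obtain g where g: "g \<in> carrier (dual_group F)" "?f = codifferential g"
    unfolding dual.one_homology by blast
  have "?f x = 0" if "x \<in> kernel F F (frag_extend \<delta>)" for x
    using that g(1) hom_int_zero[of g S] by (simp add: g(2) codifferential_def mem_cycles_iff carrier_dual_iff)
  then show "(\<lambda>c\<in>carrier ?H. ?f (?r c)) = (\<lambda>c\<in>carrier ?H. 0)"
    using homology_representative(2) by (intro restrict_ext) blast
qed

end

section \<open>Tensor products\<close>

lemma frag_tensor_of [simp]: "frag_tensor (frag_of a) (frag_of b) = frag_of (a, b)"
  by (simp add: frag_tensor_def)

lemma frag_tensor_diff_left: "frag_tensor (x - y) z = frag_tensor x z - frag_tensor y z"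
  by (simp add: frag_tensor_def frag_extend_diff)

lemma frag_tensor_diff_right: "frag_tensor x (y - z) = frag_tensor x y - frag_tensor x z"
  by (induction x rule: frag_induct) (auto simp: frag_tensor_def frag_extend_diff algebra_simps)

lemma frag_tensor_zero [simp]: "frag_tensor 0 y = 0" "frag_tensor x 0 = 0"
  using frag_tensor_diff_right[of x 0 0] by (auto simp: frag_tensor_def)

lemma frag_tensor_cmul_left: "frag_tensor (frag_cmul k x) y = frag_cmul k (frag_tensor x y)"
  by (simp add: frag_tensor_def frag_extend_cmul)

lemma keys_frag_tensor:
  assumes "Poly_Mapping.keys x \<subseteq> S" "Poly_Mapping.keys y \<subseteq> T"
  shows "Poly_Mapping.keys (frag_tensor x y) \<subseteq> S \<times> T"
proof
  fix p assume "p \<in> Poly_Mapping.keys (frag_tensor x y)"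
  then obtain a where a: "a \<in> Poly_Mapping.keys x"
    "p \<in> Poly_Mapping.keys (frag_extend (\<lambda>b. frag_of (a, b)) y)"
    unfolding frag_tensor_def by (blast dest: subsetD[OF keys_frag_extend])
  then obtain b where "b \<in> Poly_Mapping.keys y" "p \<in> Poly_Mapping.keys (frag_of (a, b))"
    by (blast dest: subsetD[OF keys_frag_extend])
  with a assms show "p \<in> S \<times> T"
    by (auto simp: keys_frag_of)
qed

text \<open>The zero of the tensor product, as a coset: the formal sums of pairs that are trivial in the tensor
  product.\<close>

abbreviation tensor_zero ::
    "('a, 'c) monoid_scheme \<Rightarrow> ('b, 'd) monoid_scheme \<Rightarrow> ('a \<times> 'b \<Rightarrow>\<^sub>0 int) set" where
  "tensor_zero G H \<equiv> generate (free_Abelian_group (carrier G \<times> carrier H)) (tensor_relators G H)"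

lemma one_tensor_group: "\<one>\<^bsub>tensor_group G H\<^esub> = tensor_zero G H"
  by (simp add: tensor_group_def FactGroup_def Let_def)

locale two_groups = G: group G + H: group H for G (structure) and H (structure)
begin

abbreviation P where "P \<equiv> free_Abelian_group (carrier G \<times> carrier H)"

sublocale P: group P
  by simp

lemma tensor_relators_subset: "tensor_relators G H \<subseteq> carrier P"
  unfolding tensor_relators_def
  by (auto dest!: subsetD[OF keys_diff] simp: keys_frag_of split: if_splits)

lemma subgroup_tensor_zero: "subgroup (tensor_zero G H) P"
  by (rule P.generate_is_subgroup[OF tensor_relators_subset])

lemma tensor_zero_closed: "tensor_zero G H \<in> carrier (tensor_group G H)"
proof -
  interpret Q: comm_group "P Mod tensor_zero G H"
    by (rule comm_group.abelian_FactGroup[OF abelian_free_Abelian_group subgroup_tensor_zero])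
  show ?thesis
    using Q.one_closed by (simp add: tensor_group_def FactGroup_def Let_def)
qed

lemma tensor_zero_diff:
  assumes "x \<in> tensor_zero G H" "y \<in> tensor_zero G H"
  shows "x - y \<in> tensor_zero G H"
proof -
  have "Poly_Mapping.keys y \<subseteq> carrier G \<times> carrier H"
    using subgroup.mem_carrier[OF subgroup_tensor_zero assms(2)] by simp
  then show ?thesis
    using subgroup.m_closed[OF subgroup_tensor_zero assms(1) subgroup.m_inv_closed[OF subgroup_tensor_zero assms(2)]]
    by simp
qed

lemma tensor_zero_zero: "0 \<in> tensor_zero G H"
  using subgroup.one_closed[OF subgroup_tensor_zero] by simp

lemma tensor_zero_minus: "x \<in> tensor_zero G H \<Longrightarrow> - x \<in> tensor_zero G H"
  using tensor_zero_diff[OF tensor_zero_zero] by simp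

lemma tensor_zero_add: "x \<in> tensor_zero G H \<Longrightarrow> y \<in> tensor_zero G H \<Longrightarrow> x + y \<in> tensor_zero G H"
  using tensor_zero_diff[of x "- y"] tensor_zero_minus[of y] by simp

lemma tensor_add_left:
  "x \<in> carrier G \<Longrightarrow> y \<in> carrier G \<Longrightarrow> z \<in> carrier H \<Longrightarrow>
   frag_of (x \<otimes>\<^bsub>G\<^esub> y, z) - frag_of (x, z) - frag_of (y, z) \<in> tensor_zero G H"
  by (rule generate.incl) (auto simp: tensor_relators_def)

lemma tensor_add_right:
  "x \<in> carrier G \<Longrightarrow> y \<in> carrier H \<Longrightarrow> z \<in> carrier H \<Longrightarrow>
   frag_of (x, y \<otimes>\<^bsub>H\<^esub> z) - frag_of (x, y) - frag_of (x, z) \<in> tensor_zero G H"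
  by (rule generate.incl) (auto simp: tensor_relators_def)

lemma tensor_one_left: "z \<in> carrier H \<Longrightarrow> frag_of (\<one>\<^bsub>G\<^esub>, z) \<in> tensor_zero G H"
  using tensor_zero_minus[OF tensor_add_left[of "\<one>\<^bsub>G\<^esub>" "\<one>\<^bsub>G\<^esub>" z]] by simp

lemma tensor_one_right: "z \<in> carrier G \<Longrightarrow> frag_of (z, \<one>\<^bsub>H\<^esub>) \<in> tensor_zero G H"
  using tensor_zero_minus[OF tensor_add_right[of z "\<one>\<^bsub>H\<^esub>" "\<one>\<^bsub>H\<^esub>"]] by simp

lemma tensor_zero_induct [consumes 1, case_names zero left right diff]:
  assumes "q \<in> tensor_zero G H"
    and "R 0"
    and "\<And>x y z. x \<in> carrier G \<Longrightarrow> y \<in> carrier G \<Longrightarrow> z \<in> carrier H \<Longrightarrow>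
      R (frag_of (x \<otimes>\<^bsub>G\<^esub> y, z) - frag_of (x, z) - frag_of (y, z))"
    and "\<And>x y z. x \<in> carrier G \<Longrightarrow> y \<in> carrier H \<Longrightarrow> z \<in> carrier H \<Longrightarrow>
      R (frag_of (x, y \<otimes>\<^bsub>H\<^esub> z) - frag_of (x, y) - frag_of (x, z))"
    and diff: "\<And>x y. R x \<Longrightarrow> R y \<Longrightarrow> R (x - y)"
  shows "R q"
proof -
  have rel: "R r" if "r \<in> tensor_relators G H" for r
    using that assms(3,4) by (auto simp: tensor_relators_def)
  have minus: "R (- x)" if "R x" for x
    using diff[OF assms(2) that] by simp
  have "R q \<and> q \<in> carrier P"
    using assms(1)
  proof (induction rule: generate.induct)
    case one
    then show ?case
      using assms(2) by simp
  next
    case (incl h)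
    then show ?case
      using rel tensor_relators_subset by blast
  next
    case (inv h)
    then show ?case
      using rel minus tensor_relators_subset by (auto simp: subset_iff)
  next
    case (eng h k)
    then show ?case
      using diff[OF _ minus, of h k] P.m_closed[of h k] by simp
  qed
  then show ?thesis ..
qed

text \<open>Both terms are additive in \<open>x\<close> and in \<open>y\<close> modulo the relations of the tensor product, so it suffices to compare
  them on basis elements, where they agree. In this way two homomorphisms combine to one on the tensor
  product of free groups.\<close>

lemma frag_tensor_hom:
  assumes \<phi>: "\<phi> \<in> hom (free_Abelian_group S) G" and \<chi>: "\<chi> \<in> hom (free_Abelian_group T) H"
    and x: "Poly_Mapping.keys x \<subseteq> S" and y: "Poly_Mapping.keys y \<subseteq> T"
  shows "frag_extend (\<lambda>(u, v). frag_of (\<phi> (frag_of u), \<chi> (frag_of v))) (frag_tensor x y) -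
    frag_of (\<phi> x, \<chi> y) \<in> tensor_zero G H"
proof -
  interpret \<phi>: group_hom "free_Abelian_group S" G \<phi>
    using \<phi> by (intro group_hom.intro group_hom_axioms.intro) (auto simp: G.is_group)
  interpret \<chi>: group_hom "free_Abelian_group T" H \<chi>
    using \<chi> by (intro group_hom.intro group_hom_axioms.intro) (auto simp: H.is_group)
  let ?\<Psi> = "frag_extend (\<lambda>(u, v). frag_of (\<phi> (frag_of u), \<chi> (frag_of v)))"
  have right: "?\<Psi> (frag_tensor (frag_of u) y) - frag_of (\<phi> (frag_of u), \<chi> y) \<in> tensor_zero G H"
    if u: "u \<in> S" for u
    using y
  proof (induction y rule: frag_induct_on)
    case zero
    then show ?case
      using tensor_zero_minus[OF tensor_one_right, of "\<phi> (frag_of u)"] \<phi>.hom_closed[of "frag_of u"] \<chi>.hom_one u by simp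
  next
    case (diff y z)
    let ?a = "\<phi> (frag_of u)"
    have "\<chi> (y - z) \<otimes>\<^bsub>H\<^esub> \<chi> z = \<chi> y"
      using \<chi>.hom_mult[of "y - z" z] diff keys_diff_subset[OF diff(1,2)] by simp
    then have "frag_of (?a, \<chi> y) - frag_of (?a, \<chi> (y - z)) - frag_of (?a, \<chi> z) \<in> tensor_zero G H"
      using tensor_add_right[of ?a "\<chi> (y - z)" "\<chi> z"] \<phi>.hom_closed[of "frag_of u"] u
        \<chi>.hom_closed[of "y - z"] \<chi>.hom_closed[of z] diff keys_diff_subset[OF diff(1,2)] by simp
    from tensor_zero_add[OF tensor_zero_diff[OF diff(3,4)] this] show ?case
      by (simp add: frag_tensor_diff_right frag_extend_diff algebra_simps)
  qed (simp add: tensor_zero_zero)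
  show ?thesis
    using x
  proof (induction x rule: frag_induct_on)
    case zero
    then show ?case
      using tensor_zero_minus[OF tensor_one_left, of "\<chi> y"] \<chi>.hom_closed[of y] \<phi>.hom_one y by simp
  next
    case (diff x z)
    have "\<phi> (x - z) \<otimes>\<^bsub>G\<^esub> \<phi> z = \<phi> x"
      using \<phi>.hom_mult[of "x - z" z] diff keys_diff_subset[OF diff(1,2)] by simp
    then have "frag_of (\<phi> x, \<chi> y) - frag_of (\<phi> (x - z), \<chi> y) - frag_of (\<phi> z, \<chi> y) \<in> tensor_zero G H"
      using tensor_add_left[of "\<phi> (x - z)" "\<phi> z" "\<chi> y"] \<chi>.hom_closed[of y] y
        \<phi>.hom_closed[of "x - z"] \<phi>.hom_closed[of z] diff keys_diff_subset[OF diff(1,2)] by simp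
    from tensor_zero_add[OF tensor_zero_diff[OF diff(3,4)] this] show ?case
      by (simp add: frag_tensor_diff_left frag_extend_diff algebra_simps)
  qed (use right in blast)
qed

end

lemma pair_eval_frag_of [simp]: "pair_eval f g (frag_of (a, b)) = f a * g b"
  by (simp add: pair_eval_def keys_frag_of)

lemma pair_eval_zero [simp]: "pair_eval f g 0 = 0"
  by (simp add: pair_eval_def)

lemma pair_eval_diff: "pair_eval f g (x - y) = pair_eval f g x - pair_eval f g y"
proof -
  let ?K = "Poly_Mapping.keys x \<union> Poly_Mapping.keys y"
  have *: "pair_eval f g z = (\<Sum>p\<in>?K. Poly_Mapping.lookup z p * (f (fst p) * g (snd p)))"
    if "Poly_Mapping.keys z \<subseteq> ?K" for z
    unfolding pair_eval_def using that by (intro sum.mono_neutral_left) (auto simp: in_keys_iff)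
  show ?thesis
    using keys_diff[of x y] by (simp add: * lookup_minus left_diff_distrib sum_subtractf)
qed

lemma (in two_groups) pair_eval_tensor_zero:
  assumes "\<phi> \<in> hom G integer_group" "\<chi> \<in> hom H integer_group" "q \<in> tensor_zero G H"
  shows "pair_eval \<phi> \<chi> q = 0"
  using assms(3)
  by (induction rule: tensor_zero_induct)
    (use assms(1,2) in \<open>auto simp: pair_eval_diff hom_def distrib_left distrib_right\<close>)

section \<open>The kernel of the Kuenneth map\<close>

text \<open>The degree determines the sign in the differential of a tensor product.\<close>

locale graded_free_complex = free_complex +
  fixes deg :: "'a \<Rightarrow> nat"
  assumes deg_d: "s \<in> S \<Longrightarrow> u \<in> Poly_Mapping.keys (\<delta> s) \<Longrightarrow> deg s = Suc (deg u)"
begin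

text \<open>The sign \<open>(-1)\<close> to the degree, extended linearly. It makes the formula for the differential of \<open>x \<otimes> y\<close>
  valid for inhomogeneous \<open>x\<close>; homology classes are not split by degree, so their representatives
  are inhomogeneous in general.\<close>

definition sgn_twist :: "('a \<Rightarrow>\<^sub>0 int) \<Rightarrow> ('a \<Rightarrow>\<^sub>0 int)" where
  "sgn_twist = frag_extend (\<lambda>s. frag_cmul ((- 1) ^ deg s) (frag_of s))"

lemma keys_sgn_twist: "Poly_Mapping.keys x \<subseteq> S \<Longrightarrow> Poly_Mapping.keys (sgn_twist x) \<subseteq> S"
  unfolding sgn_twist_def
  by (rule subset_trans[OF keys_frag_extend]) (auto simp: keys_frag_of)

lemma sgn_twist_sgn_twist: "sgn_twist (sgn_twist x) = x"
  by (induction x rule: frag_induct)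
    (auto simp: sgn_twist_def frag_extend_diff frag_extend_cmul simp flip: power_mult_distrib)

lemma boundary_sgn_twist:
  "Poly_Mapping.keys x \<subseteq> S \<Longrightarrow> frag_extend \<delta> (sgn_twist x) = - sgn_twist (frag_extend \<delta> x)"
proof (induction x rule: frag_induction)
  case (one s)
  have "sgn_twist (\<delta> s) = frag_extend (\<lambda>u. frag_cmul (- ((- 1) ^ deg s)) (frag_of u)) (\<delta> s)"
    unfolding sgn_twist_def using deg_d[OF one] by (intro frag_extend_eq) auto
  then show ?case
    by (simp add: sgn_twist_def frag_extend_scaled frag_extend_frag_of frag_extend_cmul)
qed (auto simp: sgn_twist_def frag_extend_diff)

end

definition tensor_d ::
    "('a \<Rightarrow> ('a \<Rightarrow>\<^sub>0 int)) \<Rightarrow> ('a \<Rightarrow> nat) \<Rightarrow> ('b \<Rightarrow> ('b \<Rightarrow>\<^sub>0 int)) \<Rightarrow> 'a \<times> 'b \<Rightarrow> ('a \<times> 'b \<Rightarrow>\<^sub>0 int)" where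
  "tensor_d \<delta> deg \<delta>' p = frag_tensor (\<delta> (fst p)) (frag_of (snd p)) +
     frag_cmul ((- 1) ^ deg (fst p)) (frag_tensor (frag_of (fst p)) (\<delta>' (snd p)))"

text \<open>The abbreviation \<open>\<kappa>\<close> is the Kuenneth map on formal sums of pairs of homology classes, computed with
  the chosen representatives of these classes.\<close>

locale complex_pair = A: graded_free_complex S \<delta> deg + B: graded_free_complex S' \<delta>' deg'
  for S :: "'a set" and \<delta> deg and S' :: "'b set" and \<delta>' deg'
begin

abbreviation "HA \<equiv> cx_homology A.F (frag_extend \<delta>)"
abbreviation "HB \<equiv> cx_homology B.F (frag_extend \<delta>')"
abbreviation "dT \<equiv> frag_extend (tensor_d \<delta> deg \<delta>')"
abbreviation "AB \<equiv> free_Abelian_group (S \<times> S')"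
abbreviation "\<kappa> \<equiv> frag_extend (\<lambda>(a, b). frag_tensor (SOME x. x \<in> a) (SOME y. y \<in> b))"

sublocale two_groups HA HB
  using A.comm_group_homology B.comm_group_homology
  by (simp add: two_groups_def comm_group_def)

lemma tensor_boundary:
  "dT (frag_tensor x y) = frag_tensor (frag_extend \<delta> x) y + frag_tensor (A.sgn_twist x) (frag_extend \<delta>' y)"
proof (induction x rule: frag_induct)
  case (one a)
  show ?case
  proof (induction y rule: frag_induct)
    case (one b)
    then show ?case
      by (simp add: tensor_d_def A.sgn_twist_def frag_tensor_cmul_left)
  next
    case (diff y z)
    then show ?case
      by (simp add: frag_tensor_diff_right frag_extend_diff)
  qed simp
next
  case (diff x z)
  then show ?case
    by (simp add: frag_tensor_diff_left frag_extend_diff A.sgn_twist_def)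
qed (simp add: A.sgn_twist_def)

lemma boundary_tensor_cycle:
  assumes "x \<in> frag_extend \<delta> ` carrier A.F" "z \<in> kernel B.F B.F (frag_extend \<delta>')"
  shows "frag_tensor x z \<in> dT ` carrier AB"
proof -
  obtain u where u: "x = frag_extend \<delta> u" "Poly_Mapping.keys u \<subseteq> S"
    using assms(1) by auto
  show ?thesis
  proof (rule image_eqI)
    show "frag_tensor x z = dT (frag_tensor u z)"
      using u assms(2) by (simp add: tensor_boundary B.mem_cycles_iff)
    show "frag_tensor u z \<in> carrier AB"
      using u assms(2) by (simp add: keys_frag_tensor B.mem_cycles_iff)
  qed
qed

lemma cycle_tensor_boundary:
  assumes "z \<in> kernel A.F A.F (frag_extend \<delta>)" "y \<in> frag_extend \<delta>' ` carrier B.F"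
  shows "frag_tensor z y \<in> dT ` carrier AB"
proof -
  obtain u where u: "y = frag_extend \<delta>' u" "Poly_Mapping.keys u \<subseteq> S'"
    using assms(2) by auto
  \<comment> \<open>The twist anticommutes with the differential, so the twist of \<open>z\<close> is a cycle as well and the
    unwanted term in the boundary of the twist times \<open>u\<close> vanishes.\<close>
  have "frag_extend \<delta> (A.sgn_twist z) = 0"
    using assms(1) by (simp add: A.mem_cycles_iff A.boundary_sgn_twist) (simp add: A.sgn_twist_def)
  note z = this
  show ?thesis
  proof (rule image_eqI)
    show "frag_tensor z y = dT (frag_tensor (A.sgn_twist z) u)"
      by (simp add: tensor_boundary z u(1) A.sgn_twist_sgn_twist)
    show "frag_tensor (A.sgn_twist z) u \<in> carrier AB"
      using u assms(1) by (simp add: keys_frag_tensor A.keys_sgn_twist A.mem_cycles_iff)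
  qed
qed

lemma tensor_boundaries_diff:
  "x \<in> dT ` carrier AB \<Longrightarrow> y \<in> dT ` carrier AB \<Longrightarrow> x - y \<in> dT ` carrier AB"
  by (auto simp: keys_diff_subset simp flip: frag_extend_diff)

text \<open>The chosen representatives are not additive, but they are so up to boundaries, and the product of a
  boundary with a cycle is a boundary.\<close>

lemma kuenneth_kills_tensor_zero:
  assumes "q \<in> tensor_zero HA HB"
  shows "\<kappa> q \<in> dT ` carrier AB"
  using assms
proof (induction rule: tensor_zero_induct)
  case zero
  then show ?case
    by (intro image_eqI[of _ _ 0]) auto
next
  case (left x y z)
  let ?r = "\<lambda>c. SOME x. x \<in> c"
  note x = A.homology_representative[OF left(1)] and y = A.homology_representative[OF left(2)]
    and xy = A.homology_representative[OF G.m_closed[OF left(1,2)]] and z = B.homology_representative[OF left(3)]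
  have "cx_class A.F (frag_extend \<delta>) (?r (x \<otimes>\<^bsub>HA\<^esub> y)) = cx_class A.F (frag_extend \<delta>) (?r x + ?r y)"
    using A.mult_homology[of "?r x" "?r y"] x y xy by (simp add: A.mem_cycles_iff)
  then have "?r (x \<otimes>\<^bsub>HA\<^esub> y) - (?r x + ?r y) \<in> frag_extend \<delta> ` carrier A.F"
    using x(2) y(2) xy(2) keys_add_subset[of "?r x" S "?r y"]
    by (subst (asm) A.cx_class_frag_eq_iff) (simp_all add: A.mem_cycles_iff)
  from boundary_tensor_cycle[OF this z(2)] show ?case
    by (simp add: frag_extend_diff frag_tensor_diff_left diff_diff_add[symmetric])
next
  case (right x y z)
  let ?r = "\<lambda>c. SOME x. x \<in> c"
  note x = A.homology_representative[OF right(1)] and y = B.homology_representative[OF right(2)]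
    and yz = B.homology_representative[OF H.m_closed[OF right(2,3)]] and z = B.homology_representative[OF right(3)]
  have "cx_class B.F (frag_extend \<delta>') (?r (y \<otimes>\<^bsub>HB\<^esub> z)) = cx_class B.F (frag_extend \<delta>') (?r y + ?r z)"
    using B.mult_homology[of "?r y" "?r z"] z y yz by (simp add: B.mem_cycles_iff)
  then have "?r (y \<otimes>\<^bsub>HB\<^esub> z) - (?r y + ?r z) \<in> frag_extend \<delta>' ` carrier B.F"
    using z(2) y(2) yz(2) keys_add_subset[of "?r y" S' "?r z"]
    by (subst (asm) B.cx_class_frag_eq_iff) (simp_all add: B.mem_cycles_iff)
  from cycle_tensor_boundary[OF x(2) this] show ?case
    by (simp add: frag_extend_diff frag_tensor_diff_right diff_diff_add[symmetric])
next
  case (diff x y)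
  then show ?case
    by (simp only: frag_extend_diff tensor_boundaries_diff)
qed

text \<open>The projections \<open>\<phi>\<close> and \<open>\<chi>\<close> from chains to homology combine to a map \<open>\<Psi>\<close> that sends boundaries of the tensor
  product to zero, because one tensor factor of each term of such a boundary is itself a boundary. On the
  other hand \<open>\<Psi> \<circ> \<kappa>\<close> is the identity modulo the relations of the tensor product.\<close>

lemma kuenneth_injective:
  assumes q: "Poly_Mapping.keys q \<subseteq> carrier HA \<times> carrier HB" and \<kappa>: "\<kappa> q \<in> dT ` carrier AB"
  shows "q \<in> tensor_zero HA HB"
proof -
  obtain \<phi> where \<phi>: "\<phi> \<in> hom A.F HA"
    "\<And>x. x \<in> kernel A.F A.F (frag_extend \<delta>) \<Longrightarrow> \<phi> x = cx_class A.F (frag_extend \<delta>) x"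
    "\<And>x. Poly_Mapping.keys x \<subseteq> S \<Longrightarrow> \<phi> (frag_extend \<delta> x) = \<one>\<^bsub>HA\<^esub>"
    using A.homology_projection by blast
  obtain \<chi> where \<chi>: "\<chi> \<in> hom B.F HB"
    "\<And>x. x \<in> kernel B.F B.F (frag_extend \<delta>') \<Longrightarrow> \<chi> x = cx_class B.F (frag_extend \<delta>') x"
    "\<And>x. Poly_Mapping.keys x \<subseteq> S' \<Longrightarrow> \<chi> (frag_extend \<delta>' x) = \<one>\<^bsub>HB\<^esub>"
    using B.homology_projection by blast
  define \<Psi> where "\<Psi> = frag_extend (\<lambda>(u, v). frag_of (\<phi> (frag_of u), \<chi> (frag_of v)))"
  have \<Psi>: "\<Psi> (frag_tensor x y) - frag_of (\<phi> x, \<chi> y) \<in> tensor_zero HA HB"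
    if "Poly_Mapping.keys x \<subseteq> S" "Poly_Mapping.keys y \<subseteq> S'" for x y
    unfolding \<Psi>_def by (rule frag_tensor_hom[OF \<phi>(1) \<chi>(1) that])
  have \<Psi>0: "\<Psi> (frag_tensor x y) \<in> tensor_zero HA HB"
    if "Poly_Mapping.keys x \<subseteq> S" "Poly_Mapping.keys y \<subseteq> S'" "\<phi> x = \<one>\<^bsub>HA\<^esub> \<or> \<chi> y = \<one>\<^bsub>HB\<^esub>" for x y
  proof -
    have "frag_of (\<phi> x, \<chi> y) \<in> tensor_zero HA HB"
      using that tensor_one_left[of "\<chi> y"] tensor_one_right[of "\<phi> x"] hom_in_carrier[OF \<phi>(1)] hom_in_carrier[OF \<chi>(1)]
      by auto
    from tensor_zero_add[OF \<Psi>[OF that(1,2)] this] show ?thesis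
      by simp
  qed
  have bd: "\<Psi> (dT w) \<in> tensor_zero HA HB" if "Poly_Mapping.keys w \<subseteq> S \<times> S'" for w
    using that
  proof (induction w rule: frag_induction)
    case zero
    then show ?case
      by (simp add: \<Psi>_def tensor_zero_zero)
  next
    case (one p)
    obtain u v where p: "p = (u, v)" "u \<in> S" "v \<in> S'"
      using one by auto
    have 1: "\<Psi> (frag_tensor (\<delta> u) (frag_of v)) \<in> tensor_zero HA HB"
      using p A.keys_d \<phi>(3)[of "frag_of u"] by (intro \<Psi>0) auto
    have "\<Psi> (frag_tensor (frag_of u) (\<delta>' v)) \<in> tensor_zero HA HB"
      using p B.keys_d \<chi>(3)[of "frag_of v"] by (intro \<Psi>0) auto
    then have "frag_cmul ((- 1) ^ n) (\<Psi> (frag_tensor (frag_of u) (\<delta>' v))) \<in> tensor_zero HA HB" for n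
      using tensor_zero_minus by (cases "even n") auto
    from tensor_zero_add[OF 1 this] show ?case
      by (simp add: p tensor_d_def \<Psi>_def frag_extend_add frag_extend_cmul)
  next
    case (diff a b)
    then show ?case
      using tensor_zero_diff by (simp add: \<Psi>_def frag_extend_diff)
  qed
  have "\<Psi> (\<kappa> q) - q \<in> tensor_zero HA HB"
    using q
  proof (induction q rule: frag_induction)
    case (one p)
    obtain a b where p: "p = (a, b)" "a \<in> carrier HA" "b \<in> carrier HB"
      using one by auto
    show ?case
      using \<Psi>[of "SOME x. x \<in> a" "SOME x. x \<in> b"] A.homology_representative[OF p(2)]
        B.homology_representative[OF p(3)] by (simp add: p(1) \<phi>(2) \<chi>(2) A.mem_cycles_iff B.mem_cycles_iff)
  next
    case (diff a b)
    then show ?case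
      using tensor_zero_diff[OF diff] by (simp add: \<Psi>_def frag_extend_diff algebra_simps)
  qed (simp add: \<Psi>_def tensor_zero_zero)
  moreover have "\<Psi> (\<kappa> q) \<in> tensor_zero HA HB"
    using \<kappa> bd by auto
  ultimately show ?thesis
    using tensor_zero_diff[of "\<Psi> (\<kappa> q)" "\<Psi> (\<kappa> q) - q"] by simp
qed

lemma kuenneth_eq_boundaries_iff:
  assumes t: "t \<in> carrier (tensor_group HA HB)"
  shows "(\<Union>q\<in>t. cx_class AB dT (\<kappa> q)) = dT ` carrier AB \<longleftrightarrow> t = tensor_zero HA HB"
proof
  have sub: "subgroup (tensor_zero HA HB) P"
    by (rule subgroup_tensor_zero)
  obtain q where q: "Poly_Mapping.keys q \<subseteq> carrier HA \<times> carrier HB" "t = tensor_zero HA HB #>\<^bsub>P\<^esub> q"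
    using t by (auto simp: tensor_group_def FactGroup_def RCOSETS_def Let_def)
  have zero: "0 \<in> dT ` carrier AB"
    by (intro image_eqI[of _ _ 0]) auto
  have mem: "y \<in> cx_class AB dT x \<longleftrightarrow> y - x \<in> dT ` carrier AB" for x y
    by (force simp: cx_class_def r_coset_def algebra_simps)
  {
    assume eq: "(\<Union>q\<in>t. cx_class AB dT (\<kappa> q)) = dT ` carrier AB"
    have "q \<in> t"
      using P.rcos_self[OF _ sub, of q] q by simp
    then have "\<kappa> q \<in> dT ` carrier AB"
      using mem[of "\<kappa> q" "\<kappa> q"] zero unfolding eq[symmetric] by auto
    then have "q \<in> tensor_zero HA HB"
      by (rule kuenneth_injective[OF q(1)])
    then show "t = tensor_zero HA HB"
      unfolding q(2) using q(1) by (intro P.coset_join2[OF _ sub]) auto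
  }
  assume "t = tensor_zero HA HB"
  moreover have "cx_class AB dT (\<kappa> q) = dT ` carrier AB" if "q \<in> tensor_zero HA HB" for q
  proof -
    have k: "\<kappa> q \<in> dT ` carrier AB"
      by (rule kuenneth_kills_tensor_zero[OF that])
    have "y - \<kappa> q \<in> dT ` carrier AB \<longleftrightarrow> y \<in> dT ` carrier AB" for y
    proof
      assume "y - \<kappa> q \<in> dT ` carrier AB"
      from tensor_boundaries_diff[OF this tensor_boundaries_diff[OF zero k]]
      show "y \<in> dT ` carrier AB"
        by simp
    qed (rule tensor_boundaries_diff[OF _ k])
    then show ?thesis
      by (simp only: mem set_eq_iff simp_thms)
  qed
  ultimately show "(\<Union>q\<in>t. cx_class AB dT (\<kappa> q)) = dT ` carrier AB"
    using tensor_zero_zero by auto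
qed

end

section \<open>Word coproducts, letter by letter\<close>

lemma lookup_tensor_word_coprod:
  "Poly_Mapping.lookup (frag_extend (\<lambda>(a', a''). frag_extend (\<lambda>(w', w'').
       frag_cmul ((- 1) ^ (gen_deg a'' * word_deg w')) (frag_of (a' # w', a'' # w''))) y) x)
     (b # u, c # v) =
   (- 1) ^ (gen_deg c * word_deg u) * Poly_Mapping.lookup x (b, c) * Poly_Mapping.lookup y (u, v)"
  (is "Poly_Mapping.lookup (frag_extend ?F x) _ = _")
proof (induction x rule: frag_induct)
  case (one p)
  obtain a' a'' where p: "p = (a', a'')"
    by (cases p)
  show ?case unfolding p
  proof (induction y rule: frag_induct)
    case (one q)
    then show ?case
      by (cases q) (auto simp: when_def)
  next
    case (diff y z)
    then show ?case
      by (simp add: frag_extend_diff lookup_minus algebra_simps)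
  qed auto
next
  case (diff x z)
  then show ?case
    by (simp add: frag_extend_diff lookup_minus algebra_simps)
qed auto

lemma lookup_word_coprod_Cons:
  "Poly_Mapping.lookup (word_coprod t (a # w)) (b # u, c # v) =
     (- 1) ^ (gen_deg c * word_deg u) * Poly_Mapping.lookup (gen_coprod t a) (b, c) *
     Poly_Mapping.lookup (word_coprod t w) (u, v)"
  by (simp add: lookup_tensor_word_coprod)

lemma keys_word_coprod_length:
  assumes "(u, v) \<in> Poly_Mapping.keys (word_coprod t w)"
  shows "length u = length w \<and> length v = length w"
  using assms
proof (induction w arbitrary: u v)
  case (Cons a w)
  then obtain a' a'' where *: "(u, v) \<in> Poly_Mapping.keys (frag_extend (\<lambda>(w', w'').
       frag_cmul ((- 1) ^ (gen_deg a'' * word_deg w')) (frag_of (a' # w', a'' # w''))) (word_coprod t w))"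
    using keys_frag_extend by fastforce
  obtain w' w'' where "(w', w'') \<in> Poly_Mapping.keys (word_coprod t w)"
    "(u, v) \<in> Poly_Mapping.keys (frag_cmul ((- 1) ^ (gen_deg a'' * word_deg w')) (frag_of (a' # w', a'' # w'')))"
    using subsetD[OF keys_frag_extend *] by auto
  with Cons.IH show ?case
    by (auto simp: keys_frag_of)
qed auto

lemma lookup_word_coprod_zero:
  assumes "k < length w" "length u = length w" "length v = length w"
    and "Poly_Mapping.lookup (gen_coprod t (w ! k)) (u ! k, v ! k) = 0"
  shows "Poly_Mapping.lookup (word_coprod t w) (u, v) = 0"
  using assms
proof (induction w arbitrary: u v k)
  case (Cons a w)
  obtain b u' c v' where uv: "u = b # u'" "v = c # v'"
    using Cons.prems by (metis length_Suc_conv)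
  show ?case
    using Cons.prems Cons.IH[of "k - 1" u' v'] unfolding uv lookup_word_coprod_Cons
    by (cases k) auto
qed auto

lemma lookup_word_coprod_cong:
  assumes "length u = length w" "length v = length w"
    and "\<And>k. k < length w \<Longrightarrow> Poly_Mapping.lookup (gen_coprod t (w ! k)) (u ! k, v ! k) =
           Poly_Mapping.lookup (gen_coprod t' (w ! k)) (u ! k, v ! k)"
  shows "Poly_Mapping.lookup (word_coprod t w) (u, v) = Poly_Mapping.lookup (word_coprod t' w) (u, v)"
  using assms
proof (induction w arbitrary: u v)
  case (Cons a w)
  obtain b u' c v' where uv: "u = b # u'" "v = c # v'"
    using Cons.prems by (metis length_Suc_conv)
  have "Poly_Mapping.lookup (word_coprod t w) (u', v') = Poly_Mapping.lookup (word_coprod t' w) (u', v')"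
    using Cons.prems(3)[of "Suc _"] Cons.prems uv by (intro Cons.IH) auto
  then show ?case
    using Cons.prems(3)[of 0] unfolding uv lookup_word_coprod_Cons by simp
qed simp

lemma lookup_pair_proj:
  "Poly_Mapping.lookup (pair_proj s' s'' z) (u, v) =
     (if word_index u = s' \<and> word_index v = s'' then Poly_Mapping.lookup z (u, v) else 0)"
proof (induction z rule: frag_induct)
  case (one p)
  then show ?case
    by (cases p) (auto simp: pair_proj_def when_def)
next
  case (diff y z)
  then show ?case
    by (auto simp: pair_proj_def frag_extend_diff lookup_minus)
qed (auto simp: pair_proj_def)

text \<open>The arguments tell whether the position is in \<open>\<sigma>\<close>, \<open>\<omega>\<close>, \<open>\<sigma>'\<close>, \<open>\<omega>'\<close>, \<open>\<sigma>''\<close>, \<open>\<omega>''\<close>. All of the condition on three indices except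
  the membership in \<open>K\<close> is of this local nature.\<close>

fun position_cond :: "coprod_type \<Rightarrow> bool \<Rightarrow> bool \<Rightarrow> bool \<Rightarrow> bool \<Rightarrow> bool \<Rightarrow> bool \<Rightarrow> bool" where
  "position_cond Universal e n e' n' e'' n'' \<longleftrightarrow> ((e' \<or> e'') \<and> \<not> e \<longrightarrow> n \<and> \<not> (n' \<or> n''))"
| "position_cond Normal e n e' n' e'' n'' \<longleftrightarrow> (e' \<or> e'' \<longrightarrow> e) \<and> (n \<longrightarrow> n' \<or> n'')"
| "position_cond Strictly_Normal e n e' n' e'' n'' \<longleftrightarrow> (e' \<or> e'' \<longleftrightarrow> e) \<and> (n \<longleftrightarrow> n' \<or> n'')"
| "position_cond Special e n e' n' e'' n'' \<longleftrightarrow>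
     (e' \<or> e'' \<longleftrightarrow> e) \<and> \<not> (e' \<and> e'') \<and> (n \<longleftrightarrow> n' \<or> n'') \<and> \<not> (n' \<and> n'')"
| "position_cond Weakly_Special e n e' n' e'' n'' \<longleftrightarrow>
     (e' \<or> e'' \<longleftrightarrow> e) \<and> \<not> (e' \<and> e'') \<and> (n' \<or> n'' \<longrightarrow> n) \<and> \<not> (n' \<and> n'')"

lemma loc_cond_iff_positions:
  "loc_cond t K (\<sigma>, \<omega>) (\<sigma>', \<omega>') (\<sigma>'', \<omega>'') \<longleftrightarrow>
     (\<forall>k. position_cond t (k \<in> \<sigma>) (k \<in> \<omega>) (k \<in> \<sigma>') (k \<in> \<omega>') (k \<in> \<sigma>'') (k \<in> \<omega>'')) \<and>
     (t \<in> {Universal, Weakly_Special} \<longrightarrow> \<omega> - (\<omega>' \<union> \<omega>'') \<in> K)"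
  by (cases t) (simp_all, blast+)

definition letter_cond :: "coprod_type \<Rightarrow> gen \<Rightarrow> gen \<Rightarrow> gen \<Rightarrow> bool" where
  "letter_cond t a b c \<longleftrightarrow>
     position_cond t (a = Ge) (a \<in> {Gn, Gnb}) (b = Ge) (b \<in> {Gn, Gnb}) (c = Ge) (c \<in> {Gn, Gnb})"

lemma letter_cond_if_nonzero:
  "Poly_Mapping.lookup (gen_coprod t a) (b, c) \<noteq> 0 \<Longrightarrow> letter_cond t a b c"
  by (cases t; cases a; cases b; cases c; simp add: letter_cond_def frag_list_def lookup_add)

text \<open>The letters \<open>n\<close> and \<open>n\<close>-bar have the same index, so indices alone cannot tell which of their coproduct
  terms vanish. What matters is the case that the index \<open>n\<close> disappears: only \<open>n\<close>-bar contributes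
  there, which ties \<open>\<omega> - (\<omega>' \<union> \<omega>'')\<close> to \<open>K\<close>.\<close>

lemma Gnb_if_nonzero:
  "Poly_Mapping.lookup (gen_coprod t a) (b, c) \<noteq> 0 \<Longrightarrow> a \<in> {Gn, Gnb} \<Longrightarrow>
   b \<notin> {Gn, Gnb} \<Longrightarrow> c \<notin> {Gn, Gnb} \<Longrightarrow> a = Gnb"
  by (cases t; cases a; cases b; cases c; simp add: frag_list_def lookup_add)

text \<open>For the letter \<open>n\<close> and the pair \<open>ii\<close> the condition of the weakly special type holds although neither coefficient
  is \<open>1\<close>: both are zero then.\<close>

lemma gen_coprod_universal:
  "letter_cond t a b c \<Longrightarrow>
   Poly_Mapping.lookup (gen_coprod t a) (b, c) = Poly_Mapping.lookup (gen_coprod Universal a) (b, c)"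
  by (cases t; cases a; cases b; cases c; simp add: letter_cond_def frag_list_def lookup_add)

lemma word_index_letter:
  assumes "word_index w = (\<sigma>, \<omega>)" "k < length w"
  shows "Suc k \<in> \<sigma> \<longleftrightarrow> w ! k = Ge" "Suc k \<in> \<omega> \<longleftrightarrow> w ! k \<in> {Gn, Gnb}"
  using assms by (auto simp: word_index_def)

lemma letters_satisfy_loc_cond:
  assumes "length u = length w" "length v = length w" "k < length w"
    and "loc_cond t K (word_index w) (word_index u) (word_index v)"
  shows "letter_cond t (w ! k) (u ! k) (v ! k)"
proof -
  obtain \<sigma> \<omega> \<sigma>' \<omega>' \<sigma>'' \<omega>''
    where i: "word_index w = (\<sigma>, \<omega>)" "word_index u = (\<sigma>', \<omega>')" "word_index v = (\<sigma>'', \<omega>'')"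
    by (metis surj_pair)
  have "position_cond t (Suc k \<in> \<sigma>) (Suc k \<in> \<omega>) (Suc k \<in> \<sigma>') (Suc k \<in> \<omega>') (Suc k \<in> \<sigma>'') (Suc k \<in> \<omega>'')"
    using assms(4) unfolding i loc_cond_iff_positions by blast
  then show ?thesis
    using i assms by (simp only: letter_cond_def word_index_letter)
qed

text \<open>All letter coefficients are nonzero, which gives the conditions at the positions. As for \<open>K\<close>, there is a
  simplex \<open>\<tau> \<in> K\<close> outside of which all letters of \<open>w\<close> are \<open>n\<close> or \<open>i\<close>. It contains every position with letter
  \<open>n\<close>-bar, in particular all of \<open>\<omega> - (\<omega>' \<union> \<omega>'')\<close>.\<close>

lemma loc_cond_if_nonzero:
  assumes K: "simplicial_complex_on m K" and w: "w \<in> T_basis m K"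
    and nz: "Poly_Mapping.lookup (word_coprod t w) (u, v) \<noteq> 0"
  shows "loc_cond t K (word_index w) (word_index u) (word_index v)"
proof -
  have len: "length w = m" "length u = length w" "length v = length w"
    using w keys_word_coprod_length[of u v t w] nz by (auto simp: T_basis_def in_keys_iff)
  have letter: "Poly_Mapping.lookup (gen_coprod t (w ! k)) (u ! k, v ! k) \<noteq> 0" if "k < m" for k
    using lookup_word_coprod_zero[of k w u v t] that len nz by blast
  obtain \<sigma> \<omega> \<sigma>' \<omega>' \<sigma>'' \<omega>''
    where i: "word_index w = (\<sigma>, \<omega>)" "word_index u = (\<sigma>', \<omega>')" "word_index v = (\<sigma>'', \<omega>'')"
    by (metis surj_pair)
  obtain \<tau> where \<tau>: "\<tau> \<in> K" "\<forall>k\<in>{1..m}. w ! (k - 1) \<in> (if k \<in> \<tau> then UNIV else {Gn, Gi})"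
    using w unfolding T_basis_def by blast
  have "position_cond t (k \<in> \<sigma>) (k \<in> \<omega>) (k \<in> \<sigma>') (k \<in> \<omega>') (k \<in> \<sigma>'') (k \<in> \<omega>'')" for k
  proof (cases "k \<in> {1..m}")
    case True
    then obtain j where j: "k = Suc j" "j < m"
      by (metis Suc_le_lessD atLeastAtMost_iff One_nat_def Suc_le_D)
    show ?thesis
      using letter_cond_if_nonzero[OF letter[OF j(2)]] j len i
      by (simp only: letter_cond_def word_index_letter)
  next
    case False
    then have "k \<notin> \<sigma> \<union> \<omega> \<union> \<sigma>' \<union> \<omega>' \<union> \<sigma>'' \<union> \<omega>''"
      using i len by (auto simp: word_index_def)
    then show ?thesis
      by (cases t) auto
  qed
  moreover have "\<omega> - (\<omega>' \<union> \<omega>'') \<in> K"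
  proof -
    have "\<omega> - (\<omega>' \<union> \<omega>'') \<subseteq> \<tau>"
    proof
      fix k assume k: "k \<in> \<omega> - (\<omega>' \<union> \<omega>'')"
      then have "k \<in> {1..m}"
        using i len by (auto simp: word_index_def)
      then obtain j where j: "k = Suc j" "j < m"
        by (metis Suc_le_lessD atLeastAtMost_iff One_nat_def Suc_le_D)
      have "w ! j = Gnb"
        using k j len word_index_letter(2)[OF i(1), of j] word_index_letter(2)[OF i(2), of j]
          word_index_letter(2)[OF i(3), of j]
        by (intro Gnb_if_nonzero[OF letter[OF j(2)]]) auto
      then show "k \<in> \<tau>"
        using bspec[OF \<tau>(2), of k] j by (auto split: if_splits)
    qed
    then show ?thesis
      using K \<tau>(1) by (auto simp: simplicial_complex_on_def)
  qed
  ultimately show ?thesis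
    unfolding i loc_cond_iff_positions by blast
qed

text \<open>Serves to compare with the universal coproduct and, with \<open>F w = 0\<close>, with zero.\<close>

lemma loc_psi_cong:
  assumes "\<And>w u v. w \<in> local_basis m K s \<Longrightarrow> word_index u = s' \<Longrightarrow> word_index v = s'' \<Longrightarrow>
      Poly_Mapping.lookup (word_coprod t w) (u, v) = Poly_Mapping.lookup (F w) (u, v)"
    and "Poly_Mapping.keys x \<subseteq> local_basis m K s"
  shows "loc_psi t m K s s' s'' x = pair_proj s' s'' (frag_extend F x)"
proof -
  have "pair_proj s' s'' (word_coprod t w) = pair_proj s' s'' (F w)" if "w \<in> local_basis m K s" for w
  proof (rule poly_mapping_eqI)
    fix p :: "gen list \<times> gen list"
    show "Poly_Mapping.lookup (pair_proj s' s'' (word_coprod t w)) p =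
          Poly_Mapping.lookup (pair_proj s' s'' (F w)) p"
      by (cases p) (simp add: lookup_pair_proj assms(1)[OF that])
  qed
  with assms(2) have "pair_proj s' s'' (total_psi t x) = pair_proj s' s'' (frag_extend F x)"
    by (induction x rule: frag_induction) (auto simp: total_psi_def pair_proj_def frag_extend_diff)
  then show ?thesis
    using assms(2) by (simp add: loc_psi_def T_loc_def)
qed

lemma loc_psi_universal:
  assumes "loc_cond t K s s' s''"
  shows "loc_psi t m K s s' s'' = loc_psi Universal m K s s' s''"
proof -
  have eq: "Poly_Mapping.lookup (word_coprod t w) (u, v) = Poly_Mapping.lookup (word_coprod Universal w) (u, v)"
    if w: "w \<in> local_basis m K s" and uv: "word_index u = s'" "word_index v = s''" for w u v
  proof (cases "length u = length w \<and> length v = length w")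
    case True
    then show ?thesis
      using w uv assms
      by (intro lookup_word_coprod_cong gen_coprod_universal letters_satisfy_loc_cond[where K = K])
        (auto simp: local_basis_def)
  next
    case False
    then have "(u, v) \<notin> Poly_Mapping.keys (word_coprod t w)" for t
      using keys_word_coprod_length by blast
    then show ?thesis
      by (simp add: in_keys_iff)
  qed
  show ?thesis
  proof
    fix x
    show "loc_psi t m K s s' s'' x = loc_psi Universal m K s s' s'' x"
    proof (cases "Poly_Mapping.keys x \<subseteq> local_basis m K s")
      case True
      then have "loc_psi t m K s s' s'' x = pair_proj s' s'' (frag_extend (word_coprod Universal) x)"
        using eq by (intro loc_psi_cong) auto
      also have "\<dots> = loc_psi Universal m K s s' s'' x"
        using True by (simp add: loc_psi_def T_loc_def total_psi_def)
      finally show ?thesis .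
    qed (simp add: loc_psi_def T_loc_def)
  qed
qed

lemma loc_psi_zero:
  assumes "\<not> loc_cond t K s s' s''" "simplicial_complex_on m K"
    and "x \<in> carrier (T_loc m K s)"
  shows "loc_psi t m K s s' s'' x = 0"
proof -
  have "loc_psi t m K s s' s'' x = pair_proj s' s'' (frag_extend (\<lambda>w. 0) x)"
    using assms loc_cond_if_nonzero[of m K _ t] by (intro loc_psi_cong) (auto simp: local_basis_def T_loc_def)
  then show ?thesis
    by (simp add: frag_extend_eq_0 pair_proj_def)
qed

lemma right_cond_eq_loc_cond: "right_cond t K \<omega> \<omega>' \<omega>'' \<longleftrightarrow> loc_cond t K ({}, \<omega>) ({}, \<omega>') ({}, \<omega>'')"
  by (cases t) auto

section \<open>The local complexes\<close>

text \<open>Each term of the differential turns one \<open>n\<close>-bar into \<open>n\<close>. So the differential keeps the index, keeps the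
  supporting simplex and lowers the degree by one.\<close>

lemma keys_word_d:
  "v \<in> Poly_Mapping.keys (word_d w) \<Longrightarrow> \<exists>j<length w. w ! j = Gnb \<and> v = w[j := Gn]"
proof (induction w arbitrary: v)
  case (Cons a w)
  let ?head = "frag_extend (\<lambda>b. frag_of (b # w)) (gen_d a)"
  let ?tail = "frag_cmul ((- 1) ^ gen_deg a) (frag_extend (\<lambda>v. frag_of (a # v)) (word_d w))"
  have "v \<in> Poly_Mapping.keys ?head \<or> v \<in> Poly_Mapping.keys ?tail"
    using subsetD[OF Poly_Mapping.keys_add, of v ?head ?tail] Cons.prems by auto
  then show ?case
  proof
    assume "v \<in> Poly_Mapping.keys ?head"
    then have "a = Gnb \<and> v = Gn # w"
      by (cases a) (auto simp: keys_frag_of)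
    then show ?thesis
      by (intro exI[of _ 0]) auto
  next
    assume "v \<in> Poly_Mapping.keys ?tail"
    then have "v \<in> Poly_Mapping.keys (frag_extend (\<lambda>v. frag_of (a # v)) (word_d w))"
      by simp
    then obtain v' where "v' \<in> Poly_Mapping.keys (word_d w)" "v = a # v'"
      by (auto dest!: subsetD[OF keys_frag_extend] simp: keys_frag_of)
    moreover obtain j where "j < length w" "w ! j = Gnb" "v' = w[j := Gn]"
      using Cons.IH[OF calculation(1)] by blast
    ultimately show ?thesis
      by (intro exI[of _ "Suc j"]) auto
  qed
qed simp

lemma word_d_word_d: "frag_extend word_d (word_d w) = 0"
proof (induction w)
  case (Cons a w)
  have cons: "frag_extend word_d (frag_extend (\<lambda>v. frag_of (b # v)) x) =
      frag_extend (\<lambda>v. frag_extend (\<lambda>c. frag_of (c # v)) (gen_d b)) x +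
      frag_cmul ((- 1) ^ gen_deg b) (frag_extend (\<lambda>v. frag_of (b # v)) (frag_extend word_d x))" for b x
    by (induction x rule: frag_induct) (auto simp: frag_extend_diff frag_cmul_diff_distrib2)
  show ?case
    using Cons.IH cons[of a "word_d w"]
    by (cases a) (auto simp: frag_extend_diff frag_extend_cmul frag_extend_eq_0)
qed simp

lemma word_index_update: "j < length w \<Longrightarrow> w ! j = Gnb \<Longrightarrow> word_index (w[j := Gn]) = word_index w"
  by (auto simp: word_index_def nth_list_update)

lemma word_deg_update: "j < length w \<Longrightarrow> w ! j = Gnb \<Longrightarrow> word_deg w = Suc (word_deg (w[j := Gn]))"
proof (induction w arbitrary: j)
  case (Cons a w)
  then show ?case
    by (cases j) (auto simp: word_deg_def)
qed simp

lemma T_basis_update: "w \<in> T_basis m K \<Longrightarrow> w[j := Gn] \<in> T_basis m K"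
proof -
  assume "w \<in> T_basis m K"
  then obtain \<tau> where \<tau>: "\<tau> \<in> K" "length w = m"
    "\<forall>k\<in>{1..m}. w ! (k - 1) \<in> (if k \<in> \<tau> then UNIV else {Gn, Gi})"
    unfolding T_basis_def by blast
  have "w[j := Gn] ! (k - 1) \<in> (if k \<in> \<tau> then UNIV else {Gn, Gi})" if "k \<in> {1..m}" for k
    using bspec[OF \<tau>(3) that] that \<tau>(2) by (cases "j = k - 1") auto
  with \<tau>(1,2) show ?thesis
    unfolding T_basis_def by (intro UN_I[of \<tau>]) simp_all
qed

lemma finite_T_basis: "finite (T_basis m K)"
proof (rule finite_subset)
  have "UNIV = {Gi, Gn, Gnb, Ge}"
    by (auto intro: gen.exhaust)
  then have "finite (UNIV :: gen set)"
    by (metis finite.emptyI finite_insert)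
  then show "finite {w :: gen list. set w \<subseteq> UNIV \<and> length w = m}"
    by (rule finite_lists_length_eq)
qed (auto simp: T_basis_def)

lemma keys_word_d_T_basis: "w \<in> T_basis m K \<Longrightarrow> Poly_Mapping.keys (word_d w) \<subseteq> T_basis m K"
  using keys_word_d T_basis_update by blast

lemma keys_word_d_index: "v \<in> Poly_Mapping.keys (word_d w) \<Longrightarrow> word_index v = word_index w"
  using keys_word_d word_index_update by blast

lemma free_complex_T: "free_complex (T_basis m K) word_d"
  by unfold_locales (use finite_T_basis keys_word_d_T_basis word_d_word_d in auto)

lemma graded_free_complex_T_loc: "graded_free_complex (local_basis m K s) word_d word_deg"
proof
  show "finite (local_basis m K s)"
    using finite_T_basis by (simp add: local_basis_def)
  show "Poly_Mapping.keys (word_d w) \<subseteq> local_basis m K s" if "w \<in> local_basis m K s" for w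
    using that keys_word_d_T_basis keys_word_d_index by (auto simp: local_basis_def)
  show "word_deg w = Suc (word_deg v)" if "v \<in> Poly_Mapping.keys (word_d w)" for w v
    using keys_word_d[OF that] word_deg_update by blast
qed (rule word_d_word_d)

lemma pair_d_eq: "pair_d = tensor_d word_d word_deg word_d"
  by (simp add: fun_eq_iff pair_d_def tensor_d_def)

section \<open>Local operations with vanishing chain coproduct\<close>

lemma loc_pi_zero:
  assumes zero: "\<And>x. x \<in> carrier (T_loc m K s) \<Longrightarrow> loc_psi t m K s s' s'' x = 0"
  shows "loc_pi t m K s s' s'' f g = \<one>\<^bsub>D_loc m K s\<^esub>"
  unfolding loc_pi_def D_loc_def dual_group_def
  by (simp add: zero cong: restrict_cong)

text \<open>The coproduct is a preimage of the class of zero under the Kuenneth map, and zero is the only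
  such preimage.\<close>

lemma loc_hcoprod_zero:
  assumes zero: "\<And>x. x \<in> carrier (T_loc m K s) \<Longrightarrow> loc_psi t m K s s' s'' x = 0"
    and c: "c \<in> carrier (H_loc m K s)"
  shows "loc_hcoprod t m K s s' s'' c = \<one>\<^bsub>tensor_group (H_loc m K s') (H_loc m K s'')\<^esub>"
proof -
  interpret C: graded_free_complex "local_basis m K s" word_d word_deg
    by (rule graded_free_complex_T_loc)
  interpret complex_pair "local_basis m K s'" word_d word_deg "local_basis m K s''" word_d word_deg
    by (intro complex_pair.intro graded_free_complex_T_loc)
  have H: "H_loc m K s' = HA" "H_loc m K s'' = HB"
    by (simp_all add: H_loc_def T_loc_def)
  have kuenneth: "kuenneth m K s' s'' u = (\<Union>q\<in>u. cx_class AB dT (\<kappa> q))" for u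
    by (simp add: kuenneth_def TT_loc_def pair_d_eq)
  have c': "c \<in> carrier (cx_homology C.F (frag_extend word_d))"
    using c by (simp add: H_loc_def T_loc_def)
  have "cx_class (TT_loc m K s' s'') (frag_extend pair_d) (loc_psi t m K s s' s'' x) = dT ` carrier AB"
    if "x \<in> c" for x
  proof -
    have "x \<in> carrier (T_loc m K s)"
      using C.mem_homology(1)[OF c' that] by (simp add: T_loc_def C.mem_cycles_iff)
    then have "loc_psi t m K s s' s'' x = 0"
      by (rule zero)
    then show ?thesis
      unfolding TT_loc_def pair_d_eq cx_class_def r_coset_def
      by (simp only: mult_free_Abelian_group add_0_right) blast
  qed
  then have "(\<Union>x\<in>c. cx_class (TT_loc m K s' s'') (frag_extend pair_d) (loc_psi t m K s s' s'' x)) = dT ` carrier AB"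
    using C.homology_representative(1)[OF c'] by blast
  moreover have "inv_into (carrier (tensor_group HA HB)) (kuenneth m K s' s'') (dT ` carrier AB) = tensor_zero HA HB"
    unfolding inv_into_def
  proof (rule some_equality)
    show "tensor_zero HA HB \<in> carrier (tensor_group HA HB) \<and>
        kuenneth m K s' s'' (tensor_zero HA HB) = dT ` carrier AB"
      unfolding kuenneth using kuenneth_eq_boundaries_iff[OF tensor_zero_closed] tensor_zero_closed by blast
  next
    fix u assume "u \<in> carrier (tensor_group HA HB) \<and> kuenneth m K s' s'' u = dT ` carrier AB"
    then show "u = tensor_zero HA HB"
      unfolding kuenneth using kuenneth_eq_boundaries_iff[of u] by blast
  qed
  ultimately show ?thesis
    by (simp add: loc_hcoprod_def H one_tensor_group)
qed

lemma local_cocycle_vanishing_on_cycles: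
  assumes "free_abelian (H_total m K)"
    and "f \<in> hom (free_Abelian_group (local_basis m K s)) integer_group"
    and "\<And>x. Poly_Mapping.keys x \<subseteq> local_basis m K s \<Longrightarrow> frag_extend word_d x = 0 \<Longrightarrow> f x = 0"
  obtains g where "g \<in> hom (free_Abelian_group (local_basis m K s)) integer_group"
    "\<And>x. Poly_Mapping.keys x \<subseteq> local_basis m K s \<Longrightarrow> g (frag_extend word_d x) = f x"
proof -
  interpret free_complex "T_basis m K" word_d
    by (rule free_complex_T)
  have "free_abelian (cx_homology F (frag_extend word_d))"
    using assms(1) by (simp add: H_total_def T_total_def)
  moreover have "Poly_Mapping.keys (word_d w) \<subseteq> local_basis m K s" if "w \<in> local_basis m K s" for w
    using that keys_word_d_T_basis[of w m K] keys_word_d_index[of _ w] by (auto simp: local_basis_def)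
  moreover have "Poly_Mapping.keys (word_d w) \<subseteq> T_basis m K - local_basis m K s"
    if "w \<in> T_basis m K - local_basis m K s" for w
    using that keys_word_d_T_basis[of w m K] keys_word_d_index[of _ w] by (auto simp: local_basis_def)
  moreover have "local_basis m K s \<subseteq> T_basis m K"
    by (auto simp: local_basis_def)
  ultimately show thesis
    using cocycle_vanishing_on_cycles_summand[of "local_basis m K s" f] assms(2,3) that by blast
qed

lemma codiff_eq: "codiff m K s = free_complex.codifferential (local_basis m K s) word_d"
proof -
  interpret graded_free_complex "local_basis m K s" word_d word_deg
    by (rule graded_free_complex_T_loc)
  show ?thesis
    by (simp add: fun_eq_iff codiff_def codifferential_def T_loc_def)
qed

text \<open>Pairing with the vanishing coproduct gives the zero functional on homology; freeness of the
  total homology makes the zero class the only one that evaluates to it.\<close>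

lemma loc_hprod_zero:
  assumes free: "free_abelian (H_total m K)"
    and zero: "\<And>x. x \<in> carrier (T_loc m K s) \<Longrightarrow> loc_psi t m K s s' s'' x = 0"
    and ab: "a \<in> carrier (Hco_loc m K s')" "b \<in> carrier (Hco_loc m K s'')"
  shows "loc_hprod t m K s s' s'' a b = \<one>\<^bsub>Hco_loc m K s\<^esub>"
proof -
  interpret C: graded_free_complex "local_basis m K s" word_d word_deg
    by (rule graded_free_complex_T_loc)
  interpret complex_pair "local_basis m K s'" word_d word_deg "local_basis m K s''" word_d word_deg
    by (intro complex_pair.intro graded_free_complex_T_loc)
  let ?H = "cx_homology C.F (frag_extend word_d)"
  have H: "H_loc m K s = ?H" "H_loc m K s' = HA" "H_loc m K s'' = HB"
    by (simp_all add: H_loc_def T_loc_def)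
  have Hco: "Hco_loc m K s = cx_homology (dual_group C.F) C.codifferential"
    "Hco_loc m K s' = cx_homology (dual_group A.F) A.codifferential"
    "Hco_loc m K s'' = cx_homology (dual_group B.F) B.codifferential"
    by (simp_all add: Hco_loc_def D_loc_def T_loc_def codiff_eq)
  have ev: "hom_eval m K s' a \<in> hom HA integer_group" "hom_eval m K s'' b \<in> hom HB integer_group"
    using A.cohomology_eval_hom[of a] B.cohomology_eval_hom[of b] ab
    by (simp_all add: hom_eval_def H Hco)
  have "tensor_eval (hom_eval m K s' a) (hom_eval m K s'' b) (tensor_zero HA HB) = 0"
    unfolding tensor_eval_def
    by (rule pair_eval_tensor_zero[OF ev]) (rule someI[of _ 0], rule tensor_zero_zero)
  then have "(\<lambda>c\<in>carrier (H_loc m K s).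
      tensor_eval (hom_eval m K s' a) (hom_eval m K s'' b) (loc_hcoprod t m K s s' s'' c)) = (\<lambda>c\<in>carrier ?H. 0)"
    unfolding H
    by (intro restrict_ext) (simp add: loc_hcoprod_zero[OF zero] H one_tensor_group)
  moreover have "inv_into (carrier (Hco_loc m K s)) (hom_eval m K s) (\<lambda>c\<in>carrier ?H. 0) = \<one>\<^bsub>Hco_loc m K s\<^esub>"
    unfolding inv_into_def
  proof (rule some_equality)
    have iff: "hom_eval m K s u = (\<lambda>c\<in>carrier ?H. 0) \<longleftrightarrow> u = \<one>\<^bsub>Hco_loc m K s\<^esub>"
      if "u \<in> carrier (Hco_loc m K s)" for u
      unfolding hom_eval_def H Hco
    proof (rule C.cohomology_eval_zero_iff)
      fix f assume "f \<in> hom C.F integer_group" "\<And>x. x \<in> kernel C.F C.F (frag_extend word_d) \<Longrightarrow> f x = 0"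
      then show "\<exists>g\<in>hom C.F integer_group. \<forall>x. Poly_Mapping.keys x \<subseteq> local_basis m K s \<longrightarrow>
          g (frag_extend word_d x) = f x"
        using local_cocycle_vanishing_on_cycles[OF free, of f s] by (metis C.mem_cycles_iff)
    qed (use that Hco in simp)
    interpret Hco: comm_group "Hco_loc m K s"
      unfolding Hco by (rule C.dual.comm_group_homology)
    show "\<one>\<^bsub>Hco_loc m K s\<^esub> \<in> carrier (Hco_loc m K s) \<and> hom_eval m K s \<one>\<^bsub>Hco_loc m K s\<^esub> = (\<lambda>c\<in>carrier ?H. 0)"
      using iff[OF Hco.one_closed] by simp
    show "u = \<one>\<^bsub>Hco_loc m K s\<^esub>"
      if "u \<in> carrier (Hco_loc m K s) \<and> hom_eval m K s u = (\<lambda>c\<in>carrier ?H. 0)" for u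
      using iff[of u] that by blast
  qed
  ultimately show ?thesis
    by (simp add: loc_hprod_def)
qed

lemma loc_cup_zero:
  assumes zero: "\<And>x. x \<in> carrier (T_loc m K s) \<Longrightarrow> loc_psi t m K s s' s'' x = 0"
    and ab: "a \<in> carrier (Hco_loc m K s')" "b \<in> carrier (Hco_loc m K s'')"
  shows "loc_cup t m K s s' s'' a b = \<one>\<^bsub>Hco_loc m K s\<^esub>"
proof -
  interpret C: graded_free_complex "local_basis m K s" word_d word_deg
    by (rule graded_free_complex_T_loc)
  interpret complex_pair "local_basis m K s'" word_d word_deg "local_basis m K s''" word_d word_deg
    by (intro complex_pair.intro graded_free_complex_T_loc)
  have Hco: "Hco_loc m K s = cx_homology (dual_group C.F) C.codifferential"
    "Hco_loc m K s' = cx_homology (dual_group A.F) A.codifferential"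
    "Hco_loc m K s'' = cx_homology (dual_group B.F) B.codifferential"
    "D_loc m K s = dual_group C.F"
    by (simp_all add: Hco_loc_def D_loc_def T_loc_def codiff_eq)
  have "cx_class (dual_group C.F) C.codifferential \<one>\<^bsub>dual_group C.F\<^esub> = \<one>\<^bsub>Hco_loc m K s\<^esub>"
    using C.dual.cx_class_eq_one_iff[of "\<one>\<^bsub>dual_group C.F\<^esub>"] C.dual.boundaries_subgroup
    by (simp add: Hco C.dual.one_homology subgroup.one_closed)
  moreover have "a \<noteq> {}" "b \<noteq> {}"
    using A.dual.homology_representative(1)[of a] B.dual.homology_representative(1)[of b] ab Hco by auto
  ultimately show ?thesis
    by (simp add: loc_cup_def loc_pi_zero[OF zero] codiff_eq Hco)
qed

lemma universal_or_zero_loc_cond: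
  assumes K: "simplicial_complex_on m K"
  shows "universal_or_zero t m K s s' s'' (loc_cond t K s s' s'')"
proof (cases "loc_cond t K s s' s''")
  case True
  have psi: "loc_psi t m K s s' s'' = loc_psi Universal m K s s' s''"
    by (rule loc_psi_universal[OF True])
  have pi: "loc_pi t m K s s' s'' = loc_pi Universal m K s s' s''"
    by (simp add: loc_pi_def psi fun_eq_iff)
  have hcoprod: "loc_hcoprod t m K s s' s'' = loc_hcoprod Universal m K s s' s''"
    by (simp add: loc_hcoprod_def psi fun_eq_iff)
  show ?thesis
    using True by (simp add: universal_or_zero_def psi pi hcoprod loc_hprod_def loc_cup_def)
next
  case False
  have zero: "loc_psi t m K s s' s'' x = 0" if "x \<in> carrier (T_loc m K s)" for x
    by (rule loc_psi_zero[OF False K that])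
  show ?thesis
    using False
    by (simp add: universal_or_zero_def zero loc_pi_zero[OF zero] loc_hcoprod_zero[OF zero]
        loc_hprod_zero[OF _ zero] loc_cup_zero[OF zero] TT_loc_def)
qed

theorem theorem7p7:
  fixes m :: nat and K :: "nat set set" and t :: coprod_type
  assumes "simplicial_complex_on m K"
  shows "(\<forall>s\<in>index_set m. \<forall>s'\<in>index_set m. \<forall>s''\<in>index_set m.
            universal_or_zero t m K s s' s'' (loc_cond t K s s' s'')) \<and>
         (\<forall>\<omega> \<omega>' \<omega>''. \<omega> \<subseteq> {1..m} \<longrightarrow> \<omega>' \<subseteq> {1..m} \<longrightarrow> \<omega>'' \<subseteq> {1..m} \<longrightarrow>
            universal_or_zero t m K ({}, \<omega>) ({}, \<omega>') ({}, \<omega>'') (right_cond t K \<omega> \<omega>' \<omega>''))"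
  using universal_or_zero_loc_cond[OF assms] by (simp add: right_cond_eq_loc_cond)

end
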